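(* Let $\Sigma=(B,\sigma)$ be a signed graph whose underlying graph $B$ is a block that is neither a single edge nor a circle, and suppose $[e,C,+]$ is a positive battery and $C$ has exactly two bridges $D_1,D_2$. If both $D_1$ and $D_2$ are paths, then every edge of $D_1\cup D_2$ is a positive battery. Otherwise, no edge of $D_1\cup D_2$ is a positive battery.
   Context: A signed graph $\Sigma=(G,\sigma)$ is a finite graph $G$ with signature $\sigma:E(G)\to\{+,-\}$. A circle is a connected 2-regular subgraph; its sign is the product of its edge signs. A block is a maximal subgraph without a cutpoint. For a circle $C$, a chord is an edge not in $C$ joining two distinct vertices of $C$; a bridge of $C$ is either a chord or a connected component $D$ of $G\setminus V(C)$ together with all edges joining $D$ to $C$ (a bridge "is a path" if as a subgraph it is a path). An edge $f$ is a positive battery if it lies in exactly one positive circle; $[e,C,+]$ means $C$ is a positive circle containing $e$ and is the only positive circle containing $e$. *)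

theory Defs
  imports Main
begin

text \<open>A finite loopless multigraph is given by a vertex set V, an edge set E and an
endpoint map ends (each edge has exactly two distinct endpoints in V).
A signature is sigma :: 'e => int with values in {1,-1} (1 = positive).\<close>

definition graph :: "'v set \<Rightarrow> 'e set \<Rightarrow> ('e \<Rightarrow> 'v set) \<Rightarrow> bool" where
  "graph V E ends \<longleftrightarrow> finite V \<and> finite E \<and>
     (\<forall>e\<in>E. ends e \<subseteq> V \<and> card (ends e) = 2)"

definition signature :: "'e set \<Rightarrow> ('e \<Rightarrow> int) \<Rightarrow> bool" where
  "signature E sigma \<longleftrightarrow> (\<forall>e\<in>E. sigma e = 1 \<or> sigma e = -1)"

definition verts :: "('e \<Rightarrow> 'v set) \<Rightarrow> 'e set \<Rightarrow> 'v set" where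
  "verts ends F = \<Union> (ends ` F)"

definition connected_sub :: "('e \<Rightarrow> 'v set) \<Rightarrow> 'v set \<Rightarrow> 'e set \<Rightarrow> bool" where
  "connected_sub ends W F \<longleftrightarrow>
     (\<forall>u\<in>W. \<forall>w\<in>W. (\<lambda>x y. \<exists>f\<in>F. ends f = {x, y})\<^sup>*\<^sup>* u w)"

definition deg :: "('e \<Rightarrow> 'v set) \<Rightarrow> 'e set \<Rightarrow> 'v \<Rightarrow> nat" where
  "deg ends F v = card {f\<in>F. v \<in> ends f}"

definition is_circle :: "'e set \<Rightarrow> ('e \<Rightarrow> 'v set) \<Rightarrow> 'e set \<Rightarrow> bool" where
  "is_circle E ends C \<longleftrightarrow> C \<noteq> {} \<and> C \<subseteq> E \<and>
     (\<forall>v\<in>verts ends C. deg ends C v = 2) \<and> connected_sub ends (verts ends C) C"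

definition positive :: "('e \<Rightarrow> int) \<Rightarrow> 'e set \<Rightarrow> bool" where
  "positive sigma C \<longleftrightarrow> (\<Prod>e\<in>C. sigma e) = 1"

definition is_block :: "'v set \<Rightarrow> 'e set \<Rightarrow> ('e \<Rightarrow> 'v set) \<Rightarrow> bool" where
  "is_block V E ends \<longleftrightarrow> V \<noteq> {} \<and> connected_sub ends V E \<and>
     (\<forall>v\<in>V. connected_sub ends (V - {v}) {f\<in>E. v \<notin> ends f})"

definition pos_battery :: "'e set \<Rightarrow> ('e \<Rightarrow> 'v set) \<Rightarrow> ('e \<Rightarrow> int) \<Rightarrow> 'e \<Rightarrow> bool" where
  "pos_battery E ends sigma f \<longleftrightarrow>
     (\<exists>!C. is_circle E ends C \<and> positive sigma C \<and> f \<in> C)"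

definition battery_circle :: "'e set \<Rightarrow> ('e \<Rightarrow> 'v set) \<Rightarrow> ('e \<Rightarrow> int) \<Rightarrow> 'e \<Rightarrow> 'e set \<Rightarrow> bool" where
  "battery_circle E ends sigma e C \<longleftrightarrow>
     is_circle E ends C \<and> positive sigma C \<and> e \<in> C \<and>
     (\<forall>C'. is_circle E ends C' \<and> positive sigma C' \<and> e \<in> C' \<longrightarrow> C' = C)"

definition components_off :: "'v set \<Rightarrow> 'e set \<Rightarrow> ('e \<Rightarrow> 'v set) \<Rightarrow> 'v set \<Rightarrow> 'v set set" where
  "components_off V E ends X =
     {K. K \<noteq> {} \<and> K \<subseteq> V - X \<and> connected_sub ends K {f\<in>E. ends f \<subseteq> K} \<and>
         (\<forall>f\<in>E. ends f \<subseteq> V - X \<and> ends f \<inter> K \<noteq> {} \<longrightarrow> ends f \<subseteq> K)}"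

definition bridges :: "'v set \<Rightarrow> 'e set \<Rightarrow> ('e \<Rightarrow> 'v set) \<Rightarrow> 'e set \<Rightarrow> ('v set \<times> 'e set) set" where
  "bridges V E ends C =
     {(ends f, {f}) | f. f \<in> E \<and> f \<notin> C \<and> ends f \<subseteq> verts ends C} \<union>
     {(K \<union> verts ends {f\<in>E. ends f \<inter> K \<noteq> {}}, {f\<in>E. ends f \<inter> K \<noteq> {}}) | K.
        K \<in> components_off V E ends (verts ends C)}"

text \<open>A subgraph (W,F) is a path: its vertices can be listed v0,...,vn without repetition
  such that F consists of exactly n edges, one joining each consecutive pair.\<close>
definition is_path :: "('e \<Rightarrow> 'v set) \<Rightarrow> 'v set \<times> 'e set \<Rightarrow> bool" where
  "is_path ends D \<longleftrightarrow> finite (snd D) \<and>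
     (\<exists>vs. distinct vs \<and> set vs = fst D \<and> length vs = card (snd D) + 1 \<and>
        (\<forall>i. i + 1 < length vs \<longrightarrow> (\<exists>f\<in>snd D. ends f = {vs ! i, vs ! (i + 1)})))"

end

theory Submission
  imports Defs
begin

text \<open>
  Everything happens in the cycle space over GF(2): the boundary of an edge set is its set of
  odd-degree vertices, circles are the minimal nonempty edge sets with empty boundary, and the sign is
  multiplicative under symmetric difference.

  Call a forest inside a bridge an ear if its boundary consists of the attachments of the bridge on
  \<open>C\<close>. Since \<open>C\<close> is the only positive circle through \<open>e\<close>, an ear closed
  by the arc of \<open>C\<close> through \<open>e\<close> is a negative circle. Three attachments would
  give three such circles with sum \<open>C\<close>, contradicting the sign of \<open>C\<close>, so a
  bridge has exactly two attachments. Adding the circles of an ear of \<open>D1\<close> and an ear of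
  \<open>D2\<close> yields a positive circle avoiding \<open>e\<close>. If both bridges are paths, each is
  its own only ear, and this is the only positive circle meeting them. Otherwise some bridge has two ears,
  and either two such positive circles pass through a given edge, or two ears, only one of which contains
  the edge, have a sum that is a positive circle inside the bridge.
\<close>

section \<open>The cycle space of a multigraph\<close>

definition odd_verts :: "('e \<Rightarrow> 'v set) \<Rightarrow> 'e set \<Rightarrow> 'v set" where
  "odd_verts ends X = {v. odd (deg ends X v)}"

text \<open>Acyclicity as linear independence over GF(2). With no nonempty even subset available, a
  subset of \<open>P\<close> is determined by its boundary (\<open>forest_unique\<close>).\<close>

definition forest :: "('e \<Rightarrow> 'v set) \<Rightarrow> 'e set \<Rightarrow> bool" where
  "forest ends P \<longleftrightarrow> (\<forall>X\<subseteq>P. odd_verts ends X = {} \<longrightarrow> X = {})"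

locale multigraph =
  fixes V :: "'v set" and E :: "'e set" and ends :: "'e \<Rightarrow> 'v set"
  assumes graph: "graph V E ends"
begin

abbreviation bnd :: "'e set \<Rightarrow> 'v set" where
  "bnd \<equiv> odd_verts ends"

lemma finite_E: "finite E"
  using graph by (auto simp: graph_def)

lemma finite_sub: "X \<subseteq> E \<Longrightarrow> finite X"
  using finite_E finite_subset by blast

lemma card_ends: "f \<in> E \<Longrightarrow> card (ends f) = 2"
  using graph by (auto simp: graph_def)

lemma ends_subset: "f \<in> E \<Longrightarrow> ends f \<subseteq> V"
  using graph by (auto simp: graph_def)

lemma other_end:
  assumes "f \<in> E" "v \<in> ends f"
  obtains w where "w \<noteq> v" "ends f = {v, w}"
proof -
  obtain x y where "ends f = {x, y}" "x \<noteq> y"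
    using card_ends[OF assms(1)] by (auto simp: card_2_iff)
  then have "(x \<noteq> v \<and> ends f = {v, x}) \<or> (y \<noteq> v \<and> ends f = {v, y})" using assms(2) by auto
  then show ?thesis using that by blast
qed

lemma bnd_empty [simp]: "bnd {} = {}"
  by (auto simp: odd_verts_def deg_def)

lemma bnd_subset_verts: "bnd X \<subseteq> verts ends X"
proof
  fix v assume "v \<in> bnd X"
  then have "{f\<in>X. v \<in> ends f} \<noteq> {}"
    by (auto simp: odd_verts_def deg_def simp del: Collect_empty_eq)
  then show "v \<in> verts ends X" by (auto simp: verts_def)
qed

lemma odd_card_sym_diff:
  assumes "finite S" "finite T"
  shows "odd (card (sym_diff S T)) \<longleftrightarrow> (odd (card S) \<noteq> odd (card T))"
proof -
  have "card S = card (S - T) + card (S \<inter> T)"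
    using assms by (metis Diff_Diff_Int Diff_subset card_Diff_subset card_Int_Diff finite_Diff add.commute)
  moreover have "card T = card (T - S) + card (S \<inter> T)"
    using assms by (metis card_Int_Diff inf_commute add.commute)
  moreover have "card (sym_diff S T) = card (S - T) + card (T - S)"
    using assms by (intro card_Un_disjoint) auto
  ultimately show ?thesis by auto
qed

lemma bnd_sym_diff:
  assumes "X \<subseteq> E" "Y \<subseteq> E"
  shows "bnd (sym_diff X Y) = sym_diff (bnd X) (bnd Y)"
proof -
  have "{f \<in> sym_diff X Y. v \<in> ends f} = sym_diff {f\<in>X. v \<in> ends f} {f\<in>Y. v \<in> ends f}" for v
    by auto
  then have "odd (deg ends (sym_diff X Y) v) \<longleftrightarrow> (odd (deg ends X v) \<noteq> odd (deg ends Y v))" for v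
    unfolding deg_def
    using odd_card_sym_diff[of "{f\<in>X. v \<in> ends f}" "{f\<in>Y. v \<in> ends f}"] finite_sub assms by simp
  then show ?thesis by (auto simp: odd_verts_def)
qed

lemma bnd_Un:
  assumes "X \<subseteq> E" "Y \<subseteq> E" "X \<inter> Y = {}"
  shows "bnd (X \<union> Y) = sym_diff (bnd X) (bnd Y)"
proof -
  have "X \<union> Y = sym_diff X Y" using assms(3) by auto
  then show ?thesis using bnd_sym_diff[OF assms(1,2)] by simp
qed

lemma bnd_Diff:
  assumes "X \<subseteq> E" "Y \<subseteq> X"
  shows "bnd (X - Y) = sym_diff (bnd X) (bnd Y)"
proof -
  have "X - Y = sym_diff X Y" using assms(2) by auto
  then show ?thesis using bnd_sym_diff[of X Y] assms by auto
qed

lemma bnd_single: "f \<in> E \<Longrightarrow> bnd {f} = ends f"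
proof -
  have "{g\<in>{f}. v \<in> ends g} = (if v \<in> ends f then {f} else {})" for v by auto
  then show ?thesis by (auto simp: odd_verts_def deg_def split: if_splits)
qed

lemma finite_bnd: "X \<subseteq> E \<Longrightarrow> finite (bnd X)"
proof -
  assume "X \<subseteq> E"
  then have "bnd X \<subseteq> V" using bnd_subset_verts[of X] ends_subset by (fastforce simp: verts_def)
  then show ?thesis using graph finite_subset by (auto simp: graph_def)
qed

text \<open>The handshake lemma: each added edge changes the boundary by a set of two
  vertices.\<close>

lemma even_card_bnd:
  assumes "X \<subseteq> E"
  shows "even (card (bnd X))"
proof -
  have "finite X" using assms finite_sub by blast
  then show ?thesis using assms
  proof (induction X)
    case empty
    then show ?case by simp
  next
    case (insert f X)
    have "bnd (insert f X) = sym_diff (bnd X) (ends f)"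
      using bnd_Un[of X "{f}"] insert by (simp add: bnd_single)
    moreover have "finite (ends f)" using card_ends[of f] insert.prems
      by (metis card.infinite insert_subset zero_neq_numeral)
    ultimately show ?case
      using odd_card_sym_diff[of "bnd X" "ends f"] insert finite_bnd[of X] card_ends[of f] by auto
  qed
qed

text \<open>Parity excludes a boundary of one vertex. This dichotomy drives the case splits at a
  pair of attachments.\<close>

lemma bnd_subset_pair:
  assumes "X \<subseteq> E" "bnd X \<subseteq> A" "card A = 2"
  shows "bnd X = {} \<or> bnd X = A"
proof -
  have "finite A" using assms(3) by (metis card.infinite zero_neq_numeral)
  then have "card (bnd X) \<le> 2" using assms card_mono by metis
  then have "card (bnd X) = 0 \<or> card (bnd X) = 2"
    using even_card_bnd[OF assms(1)] by (metis One_nat_def Suc_1 le_Suc_eq le_zero_eq odd_one)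
  then show ?thesis
    using \<open>finite A\<close> assms card_subset_eq finite_bnd by (metis card_0_eq)
qed

lemma forestD: "forest ends P \<Longrightarrow> X \<subseteq> P \<Longrightarrow> bnd X = {} \<Longrightarrow> X = {}"
  by (auto simp: forest_def)

lemma forest_subset: "forest ends P \<Longrightarrow> Q \<subseteq> P \<Longrightarrow> forest ends Q"
  by (auto simp: forest_def)

lemma forest_unique:
  assumes "forest ends P" "P \<subseteq> E" "X \<subseteq> P" "Y \<subseteq> P" "bnd X = bnd Y"
  shows "X = Y"
proof -
  have "bnd (sym_diff X Y) = {}" using bnd_sym_diff[of X Y] assms by auto
  then have "sym_diff X Y = {}" using forestD[OF assms(1), of "sym_diff X Y"] assms by blast
  then show ?thesis by blast
qed

text \<open>Summing the edges of a walk modulo 2 cancels repetitions, so no path has to be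
  extracted. Writing the ends as \<open>sym_diff {u} {v}\<close> includes the closed case
  \<open>u = v\<close>.\<close>

lemma reach_imp_bnd:
  assumes "(\<lambda>x y. \<exists>f\<in>H. ends f = {x, y})\<^sup>*\<^sup>* u v" "H \<subseteq> E"
  shows "\<exists>X\<subseteq>H. bnd X = sym_diff {u} {v}"
  using assms(1)
proof induction
  case base
  then show ?case by (intro exI[of _ "{}"]) simp
next
  case (step v w)
  then obtain X f where X: "X \<subseteq> H" "bnd X = sym_diff {u} {v}" and f: "f \<in> H" "ends f = {v, w}" by blast
  have "card {v, w} = 2" using card_ends f assms(2) by (metis subsetD)
  then have vw: "v \<noteq> w" by auto
  have "bnd (sym_diff X {f}) = sym_diff (sym_diff {u} {v}) {v, w}"
    using bnd_sym_diff[of X "{f}"] X f assms(2) by (simp add: bnd_single subset_iff)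
  also have "\<dots> = sym_diff {u} {w}" using vw by auto
  finally show ?case using X f by (intro exI[of _ "sym_diff X {f}"]) auto
qed

lemma reach_sym:
  "(\<lambda>x y. \<exists>f\<in>H. ends f = {x, y})\<^sup>*\<^sup>* u v \<Longrightarrow> (\<lambda>x y. \<exists>f\<in>H. ends f = {x, y})\<^sup>*\<^sup>* v u"
proof (induction rule: rtranclp_induct)
  case base
  then show ?case by simp
next
  case (step y z)
  then have "(\<lambda>x y. \<exists>f\<in>H. ends f = {x, y}) z y" by (auto simp: insert_commute)
  then show ?case using step.IH by (rule converse_rtranclp_into_rtranclp)
qed

lemma reach_closed:
  assumes "(\<lambda>x y. \<exists>f\<in>H. ends f = {x, y})\<^sup>*\<^sup>* u v" "u \<in> K"
    and "\<And>f. f \<in> H \<Longrightarrow> ends f \<inter> K \<noteq> {} \<Longrightarrow> ends f \<subseteq> K"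
  shows "v \<in> K"
  using assms(1,2)
proof (induction rule: rtranclp_induct)
  case (step y z)
  then obtain f where "f \<in> H" "ends f = {y, z}" by blast
  then show ?case using assms(3)[of f] step by auto
qed

definition reachable :: "'e set \<Rightarrow> 'v \<Rightarrow> 'v set" where
  "reachable H u = {v. (\<lambda>x y. \<exists>f\<in>H. ends f = {x, y})\<^sup>*\<^sup>* u v}"

lemma reachable_refl: "u \<in> reachable H u"
  by (simp add: reachable_def)

lemma reachable_ends:
  assumes "H \<subseteq> E" "f \<in> H" "ends f \<inter> reachable H u \<noteq> {}"
  shows "ends f \<subseteq> reachable H u"
proof -
  obtain v where v: "v \<in> ends f" "v \<in> reachable H u" using assms by blast
  then obtain w where "ends f = {v, w}" using other_end[of f v] assms by blast
  moreover from this have "w \<in> reachable H u" using v assms(2) unfolding reachable_def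
    by (auto intro: rtranclp.rtrancl_into_rtrancl)
  ultimately show ?thesis using v by auto
qed

lemma reachable_bnd:
  assumes "H \<subseteq> E" "v \<in> reachable H u"
  shows "\<exists>X\<subseteq>H. bnd X = sym_diff {u} {v}"
  using assms reach_imp_bnd by (auto simp: reachable_def)

lemma bnd_cong:
  assumes "\<And>f. f \<in> X \<union> Y \<Longrightarrow> v \<in> ends f \<Longrightarrow> f \<in> X \<longleftrightarrow> f \<in> Y"
  shows "v \<in> bnd X \<longleftrightarrow> v \<in> bnd Y"
proof -
  have "{f\<in>X. v \<in> ends f} = {f\<in>Y. v \<in> ends f}" using assms by auto
  then show ?thesis by (simp add: odd_verts_def deg_def)
qed

text \<open>Such a forest is a path, and this is its first step. Take an edge \<open>g\<close> at
  \<open>a\<close> with far end \<open>w\<close>. Parity forces \<open>b\<close> to be reachable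
  from \<open>w\<close> by edges of \<open>P\<close> avoiding \<open>a\<close>. A set of such edges
  joining \<open>w\<close> to \<open>b\<close>, together with \<open>g\<close>, has the boundary of
  \<open>P\<close>, so it is all of \<open>P\<close>, and \<open>g\<close> is the only edge at
  \<open>a\<close>.\<close>

lemma forest_end_edge:
  assumes P: "forest ends P" "P \<subseteq> E" "bnd P = {a, b}" "a \<noteq> b"
  shows "\<exists>g\<in>P. {f\<in>P. a \<in> ends f} = {g}"
proof -
  have "a \<in> verts ends P" using bnd_subset_verts[of P] P(3) by auto
  then obtain g where g: "g \<in> P" "a \<in> ends g" by (auto simp: verts_def)
  then obtain w where w: "w \<noteq> a" "ends g = {a, w}" using other_end[of g a] P by blast
  define Z where "Z = {f\<in>P. a \<notin> ends f}"
  have ZE: "Z \<subseteq> E" using P by (auto simp: Z_def)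
  define K where "K = reachable Z w"
  define Y where "Y = {f\<in>P. ends f \<inter> K \<noteq> {}}"
  have wK: "w \<in> K" by (simp add: K_def reachable_refl)
  \<comment> \<open>An edge of \<open>P\<close> away from \<open>a\<close> that meets
    \<open>K\<close> lies inside \<open>K\<close>. So \<open>Y\<close> has the parities of
    \<open>P\<close> on \<open>K\<close> and even degrees elsewhere, except perhaps at
    \<open>a\<close>.\<close>
  have Yv: "v \<in> bnd Y \<longleftrightarrow> v \<in> bnd P \<and> v \<in> K" if "v \<noteq> a" for v
  proof (cases "v \<in> K")
    case True
    then have "v \<in> bnd Y \<longleftrightarrow> v \<in> bnd P" by (intro bnd_cong) (auto simp: Y_def)
    then show ?thesis using True by simp
  next
    case False
    have "v \<notin> verts ends Y"
    proof
      assume "v \<in> verts ends Y"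
      then obtain f where f: "f \<in> P" "ends f \<inter> K \<noteq> {}" "v \<in> ends f" by (auto simp: verts_def Y_def)
      show False
      proof (cases "a \<in> ends f")
        case True
        have "f \<in> E" using f P by blast
        have "ends f = {a, v}" using card_ends[OF \<open>f \<in> E\<close>] True f(3) that by (auto simp: card_2_iff)
        then have "a \<in> K" using f False by auto
        moreover have "a \<notin> K"
        proof
          assume "a \<in> K"
          then have "(\<lambda>x y. \<exists>f\<in>Z. ends f = {x, y})\<^sup>*\<^sup>* w a" by (simp add: K_def reachable_def)
          then have "a \<in> - {a}" by (rule reach_closed) (use w in \<open>auto simp: Z_def\<close>)
          then show False by simp
        qed
        ultimately show False by simp
      next
        case False
        then have "ends f \<subseteq> K" using reachable_ends[OF ZE, of f w] f by (auto simp: K_def Z_def)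
        then show False using f \<open>v \<notin> K\<close> by blast
      qed
    qed
    then show ?thesis using False bnd_subset_verts[of Y] by blast
  qed
  have YP: "Y \<subseteq> P" by (auto simp: Y_def)
  \<comment> \<open>Otherwise only \<open>a\<close> could be odd in \<open>Y\<close>; by parity
    \<open>Y\<close> would be even, hence empty, although it contains \<open>g\<close>.\<close>
  have "b \<in> K"
  proof (rule ccontr)
    assume "b \<notin> K"
    then have "bnd Y \<subseteq> {a}" using Yv P(3) by blast
    moreover have "bnd Y \<noteq> {a}" using even_card_bnd[OF subset_trans[OF YP P(2)]] by auto
    ultimately have "bnd Y = {}" by auto
    then have "Y = {}" using forestD[OF P(1) YP] by simp
    moreover have "g \<in> Y" using g w wK by (auto simp: Y_def)
    ultimately show False by simp
  qed
  then obtain R where R: "R \<subseteq> Z" "bnd R = sym_diff {w} {b}"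
    using reachable_bnd[OF ZE, of b w] unfolding K_def by blast
  have "g \<notin> R" using R g by (auto simp: Z_def)
  then have "bnd (R \<union> {g}) = sym_diff (sym_diff {w} {b}) {a, w}"
    using bnd_Un[of R "{g}"] R g w ZE P(2) by (auto simp: bnd_single subset_iff)
  also have "\<dots> = {a, b}" using w P(4) by auto
  finally have "R \<union> {g} = P"
    using forest_unique[OF P(1,2), of "R \<union> {g}" P] R g P(3) by (auto simp: Z_def)
  then have "{f\<in>P. a \<in> ends f} = {g}" using R g by (auto simp: Z_def)
  then show ?thesis using g by blast
qed

text \<open>Forward: a nonempty even part has degree 2 at each vertex it touches, so it takes all
  edges there, and connectedness spreads it over the circle. Backward: removing an edge at
  \<open>v\<close> leaves a forest whose boundary is the pair of its ends, so exactly one other edge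
  meets \<open>v\<close>; the edges reachable from a vertex form an even part, hence
  everything.\<close>

lemma circle_iff_min_even:
  "is_circle E ends Z \<longleftrightarrow>
    Z \<noteq> {} \<and> Z \<subseteq> E \<and> bnd Z = {} \<and> (\<forall>X\<subseteq>Z. bnd X = {} \<longrightarrow> X = {} \<or> X = Z)"
  (is "?L \<longleftrightarrow> ?R")
proof
  assume L: ?L
  then have ZE: "Z \<subseteq> E" and ne: "Z \<noteq> {}" and d2: "\<And>v. v \<in> verts ends Z \<Longrightarrow> deg ends Z v = 2"
    and con: "connected_sub ends (verts ends Z) Z" by (auto simp: is_circle_def)
  have "v \<notin> bnd Z" for v
    using d2[of v] bnd_subset_verts[of Z] by (auto simp: odd_verts_def)
  moreover have "X = Z" if X: "X \<subseteq> Z" "bnd X = {}" "X \<noteq> {}" for X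
  proof -
    have star: "f \<in> X" if "f \<in> Z" "v \<in> ends f" "v \<in> verts ends X" for f v
    proof -
      have fin: "finite {f\<in>Z. v \<in> ends f}" using ZE finite_sub by simp
      have sub: "{f\<in>X. v \<in> ends f} \<subseteq> {f\<in>Z. v \<in> ends f}" using X by auto
      have "{f\<in>X. v \<in> ends f} \<noteq> {}" using that by (auto simp: verts_def)
      then have "deg ends X v \<noteq> 0" using fin sub finite_subset
        unfolding deg_def by (metis card_0_eq)
      moreover have "even (deg ends X v)" using X(2) by (auto simp: odd_verts_def)
      moreover have "deg ends Z v = 2" using that d2 by (auto simp: verts_def)
      moreover have "deg ends X v \<le> deg ends Z v" unfolding deg_def using card_mono[OF fin sub] .
      moreover have "n \<noteq> 0 \<Longrightarrow> even n \<Longrightarrow> m = 2 \<Longrightarrow> n \<le> m \<Longrightarrow> n = m" for n m :: nat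
        by presburger
      ultimately have "deg ends X v = deg ends Z v" by metis
      then have "{f\<in>X. v \<in> ends f} = {f\<in>Z. v \<in> ends f}"
        unfolding deg_def using card_subset_eq[OF fin sub] by simp
      then show ?thesis using that by auto
    qed
    obtain g where g: "g \<in> X" using X by blast
    then obtain u where u: "u \<in> ends g" using card_ends[of g] X ZE by fastforce
    have "f \<in> X" if f: "f \<in> Z" for f
    proof -
      obtain v where v: "v \<in> ends f" using card_ends[of f] f ZE by fastforce
      have "(\<lambda>x y. \<exists>f\<in>Z. ends f = {x, y})\<^sup>*\<^sup>* u v"
        using con u v g f X by (auto simp: connected_sub_def verts_def)
      then have "v \<in> verts ends X"
        by (rule reach_closed) (use u g star in \<open>auto simp: verts_def\<close>)
      then show ?thesis using star f v by blast
    qed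
    then show ?thesis using X by blast
  qed
  ultimately show ?R using ne ZE by blast
next
  assume R: ?R
  then have ZE: "Z \<subseteq> E" and ne: "Z \<noteq> {}" and bZ: "bnd Z = {}"
    and min: "\<And>X. X \<subseteq> Z \<Longrightarrow> bnd X = {} \<Longrightarrow> X = {} \<or> X = Z" by auto
  have "deg ends Z v = 2" if v: "v \<in> verts ends Z" for v
  proof -
    obtain f where f: "f \<in> Z" "v \<in> ends f" using v by (auto simp: verts_def)
    then obtain w where w: "w \<noteq> v" "ends f = {v, w}" using other_end[of f v] ZE by blast
    have "forest ends (Z - {f})" unfolding forest_def using min f by blast
    moreover have "bnd (Z - {f}) = {v, w}"
      using bnd_Diff[of Z "{f}"] ZE f bZ w by (auto simp: bnd_single subset_iff)
    ultimately obtain g where g: "g \<in> Z - {f}" "{h\<in>Z - {f}. v \<in> ends h} = {g}"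
      using forest_end_edge[of "Z - {f}" v w] ZE w by blast
    from g(2) have "{h\<in>Z. v \<in> ends h} = {f, g}" using f by blast
    moreover have "f \<noteq> g" using g(1) by auto
    ultimately show ?thesis by (simp add: deg_def)
  qed
  moreover have "connected_sub ends (verts ends Z) Z"
    unfolding connected_sub_def
  proof (intro ballI)
    fix u v assume u: "u \<in> verts ends Z" and v: "v \<in> verts ends Z"
    define Y where "Y = {f\<in>Z. ends f \<inter> reachable Z u \<noteq> {}}"
    have "x \<notin> bnd Y" for x
    proof (cases "x \<in> reachable Z u")
      case True
      then have "x \<in> bnd Y \<longleftrightarrow> x \<in> bnd Z" by (intro bnd_cong) (auto simp: Y_def)
      then show ?thesis using bZ by simp
    next
      case False
      then have "x \<notin> verts ends Y" using reachable_ends[OF ZE] by (fastforce simp: Y_def verts_def)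
      then show ?thesis using bnd_subset_verts[of Y] by blast
    qed
    then have "Y = {} \<or> Y = Z" using min[of Y] by (auto simp: Y_def)
    moreover have "Y \<noteq> {}" using u reachable_refl[of u Z] by (fastforce simp: Y_def verts_def)
    ultimately have "Y = Z" by simp
    obtain f where "f \<in> Z" "v \<in> ends f" using v by (auto simp: verts_def)
    then have "v \<in> reachable Z u" using \<open>Y = Z\<close> reachable_ends[OF ZE, of f u] by (auto simp: Y_def)
    then show "(\<lambda>x y. \<exists>f\<in>Z. ends f = {x, y})\<^sup>*\<^sup>* u v" by (simp add: reachable_def)
  qed
  ultimately show ?L using ne ZE by (auto simp: is_circle_def)
qed

lemma circleD:
  assumes "is_circle E ends Z"
  shows "Z \<noteq> {}" "Z \<subseteq> E" "bnd Z = {}" "\<And>X. X \<subseteq> Z \<Longrightarrow> bnd X = {} \<Longrightarrow> X = {} \<or> X = Z"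
  using assms circle_iff_min_even by auto

text \<open>Take an even subset through \<open>f\<close> of least size. If it split into two
  nonempty even parts, the one containing \<open>f\<close> would be smaller.\<close>

lemma even_contains_circle:
  assumes "X \<subseteq> E" "bnd X = {}" "f \<in> X"
  obtains Z where "is_circle E ends Z" "f \<in> Z" "Z \<subseteq> X"
proof -
  let ?P = "\<lambda>Z. Z \<subseteq> X \<and> bnd Z = {} \<and> f \<in> Z"
  obtain Z where Z: "?P Z" "\<And>Y. ?P Y \<Longrightarrow> card Z \<le> card Y"
    using ex_has_least_nat[of ?P X card] assms by auto
  have ZE: "Z \<subseteq> E" using Z assms by blast
  have fin: "finite Z" using ZE finite_sub by blast
  have "Y = {} \<or> Y = Z" if Y: "Y \<subseteq> Z" "bnd Y = {}" for Y
  proof (cases "f \<in> Y")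
    case True
    then have "card Z \<le> card Y" using Z(2)[of Y] Y Z(1) by blast
    then show ?thesis using card_seteq[OF fin Y(1)] by simp
  next
    case False
    then have "?P (Z - Y)" using bnd_Diff[OF ZE Y(1)] Y Z(1) by auto
    then have "card Z \<le> card (Z - Y)" by (rule Z(2))
    then have "Z - Y = Z" using card_seteq[OF fin, of "Z - Y"] by blast
    then show ?thesis using Y by blast
  qed
  then have "is_circle E ends Z" using circle_iff_min_even ZE Z(1) by blast
  then show ?thesis using that Z by blast
qed

lemma circle_proper_forest:
  assumes "is_circle E ends Z" "P \<subset> Z"
  shows "forest ends P"
  using circleD(4)[OF assms(1)] assms(2) unfolding forest_def by blast

end

section \<open>Blocks, spanning forests and paths\<close>

context multigraph
begin

definition concyclic :: "'e \<Rightarrow> 'e \<Rightarrow> bool" where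
  "concyclic f g \<longleftrightarrow> (\<exists>Z. is_circle E ends Z \<and> f \<in> Z \<and> g \<in> Z)"

text \<open>Prepares the exchange in \<open>concyclic_trans\<close>: otherwise \<open>Z'\<close>
  would lie in \<open>Z - Y\<close>, a proper part of the circle \<open>Z\<close>.\<close>

lemma circle_meets_outside:
  assumes "is_circle E ends Z" "is_circle E ends Z'" "Z' \<subseteq> sym_diff Z Y" "Z \<inter> Y \<noteq> {}"
  shows "Z' \<inter> (Y - Z) \<noteq> {}"
proof
  assume "Z' \<inter> (Y - Z) = {}"
  then have "Z' \<subseteq> Z - Y" using assms(3) by blast
  then have "Z' = Z" using circleD(4)[OF assms(1), of Z'] circleD(1,3)[OF assms(2)] by blast
  then show False using \<open>Z' \<subseteq> Z - Y\<close> assms(4) by blast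
qed

text \<open>Among intersecting pairs of circles, one through \<open>f\<close> and one through
  \<open>h\<close>, take a pair with the smallest union. If neither contains both edges, their sum
  contains circles \<open>X'\<close> through \<open>f\<close> and \<open>Y'\<close> through
  \<open>h\<close>. The pairs \<open>(X, Y')\<close> and then \<open>(X', Y')\<close> compete with
  the minimum, and the union of the latter misses the nonempty set
  \<open>X \<inter> Y\<close>.\<close>

lemma concyclic_trans:
  assumes "concyclic f g" "concyclic g h"
  shows "concyclic f h"
proof -
  let ?P = "\<lambda>(X, Y). is_circle E ends X \<and> is_circle E ends Y \<and> f \<in> X \<and> h \<in> Y \<and> X \<inter> Y \<noteq> {}"
  obtain X0 Y0 where "?P (X0, Y0)" using assms by (auto simp: concyclic_def)
  then obtain p where p: "?P p" "\<And>q. ?P q \<Longrightarrow> card (fst p \<union> snd p) \<le> card (fst q \<union> snd q)"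
    using ex_has_least_nat[of ?P _ "\<lambda>p. card (fst p \<union> snd p)"] by blast
  obtain X Y where XY: "p = (X, Y)" by force
  have X: "is_circle E ends X" "f \<in> X" and Y: "is_circle E ends Y" "h \<in> Y" and ne: "X \<inter> Y \<noteq> {}"
    using p(1) XY by auto
  note XE = circleD(2)[OF X(1)] and YE = circleD(2)[OF Y(1)]
  show ?thesis
  proof (cases "f \<in> Y \<or> h \<in> X")
    case True
    then show ?thesis using X Y by (auto simp: concyclic_def)
  next
    case False
    have S: "sym_diff X Y \<subseteq> E" "bnd (sym_diff X Y) = {}"
      using bnd_sym_diff[OF XE YE] XE YE circleD(3)[OF X(1)] circleD(3)[OF Y(1)] by auto
    obtain X' where X': "is_circle E ends X'" "f \<in> X'" "X' \<subseteq> sym_diff X Y"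
      using even_contains_circle[OF S, of f] False X by blast
    obtain Y' where Y': "is_circle E ends Y'" "h \<in> Y'" "Y' \<subseteq> sym_diff X Y"
      using even_contains_circle[OF S, of h] False Y by blast
    have X'Y: "X' \<inter> (Y - X) \<noteq> {}" using circle_meets_outside[OF X(1) X'(1,3) ne] .
    have Y'X: "Y' \<inter> (X - Y) \<noteq> {}" using circle_meets_outside[OF Y(1) Y'(1), of X] Y'(3) ne by blast
    have fin: "finite (X \<union> Y)" using XE YE finite_sub by blast
    have "card (X \<union> Y) \<le> card (X \<union> Y')" using p(2)[of "(X, Y')"] XY X Y' Y'X by auto
    \<comment> \<open>Minimality against \<open>(X, Y')\<close> makes \<open>Y'\<close> contain all
      of \<open>Y - X\<close>, which \<open>X'\<close> meets; so \<open>X'\<close> and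
      \<open>Y'\<close> intersect.\<close>
    then have "X \<union> Y' = X \<union> Y" using card_seteq[OF fin, of "X \<union> Y'"] Y'(3) by blast
    then have "Y - X \<subseteq> Y'" by blast
    then have "X' \<inter> Y' \<noteq> {}" using X'Y by blast
    then have "card (X \<union> Y) \<le> card (X' \<union> Y')" using p(2)[of "(X', Y')"] XY X' Y' by auto
    then have "X' \<union> Y' = X \<union> Y" using card_seteq[OF fin, of "X' \<union> Y'"] X'(3) Y'(3) by blast
    then show ?thesis using X'(3) Y'(3) ne by blast
  qed
qed

text \<open>Deleting \<open>v\<close> keeps the block connected, which joins the far ends of
  \<open>f\<close> and \<open>g\<close> away from \<open>v\<close>. In the resulting even set only
  \<open>f\<close> and \<open>g\<close> meet \<open>v\<close>, so a circle through \<open>f\<close>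
  must use \<open>g\<close>.\<close>

lemma block_adjacent_concyclic:
  assumes block: "is_block V E ends" and f: "f \<in> E" "v \<in> ends f" and g: "g \<in> E" "v \<in> ends g" and "f \<noteq> g"
  shows "concyclic f g"
proof -
  obtain x where x: "x \<noteq> v" "ends f = {v, x}" using other_end[OF f] .
  obtain y where y: "y \<noteq> v" "ends g = {v, y}" using other_end[OF g] .
  let ?H = "{h\<in>E. v \<notin> ends h}"
  have "x \<in> V" "y \<in> V" "v \<in> V" using ends_subset f g x y by auto
  then have "(\<lambda>x y. \<exists>f\<in>?H. ends f = {x, y})\<^sup>*\<^sup>* x y"
    using block x y by (auto simp: is_block_def connected_sub_def)
  then obtain R where R: "R \<subseteq> ?H" "bnd R = sym_diff {x} {y}"
    using reach_imp_bnd[of ?H x y] by blast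
  have "bnd {f, g} = sym_diff {v, x} {v, y}"
    using bnd_Un[of "{f}" "{g}"] f g x y \<open>f \<noteq> g\<close> by (simp add: bnd_single insert_commute)
  moreover have "{f, g} \<inter> R = {}" using R f g by auto
  ultimately have "bnd ({f, g} \<union> R) = sym_diff (sym_diff {v, x} {v, y}) (sym_diff {x} {y})"
    using bnd_Un[of "{f, g}" R] R f g by (auto simp: subset_iff)
  also have "\<dots> = {}" using x y by auto
  finally obtain Z where Z: "is_circle E ends Z" "f \<in> Z" "Z \<subseteq> {f, g} \<union> R"
    using even_contains_circle[of "{f, g} \<union> R" f] R f g by blast
  have "g \<in> Z"
  proof (rule ccontr)
    assume "g \<notin> Z"
    then have "v \<in> bnd Z \<longleftrightarrow> v \<in> bnd {f}" using Z R by (intro bnd_cong) auto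
    then show False using circleD(3)[OF Z(1)] f by (simp add: bnd_single)
  qed
  then show ?thesis using Z by (auto simp: concyclic_def)
qed

lemma block_concyclic:
  assumes block: "is_block V E ends" and f: "f \<in> E" and g: "g \<in> E" and "f \<noteq> g"
  shows "concyclic f g"
proof -
  obtain a where a: "a \<in> ends f" using card_ends[OF f] by fastforce
  obtain b where b: "b \<in> ends g" using card_ends[OF g] by fastforce
  have "(\<lambda>x y. \<exists>f\<in>E. ends f = {x, y})\<^sup>*\<^sup>* a b"
    using block ends_subset f g a b unfolding is_block_def connected_sub_def by blast
  \<comment> \<open>The invariant carried along the walk concerns all edges at the current vertex.
    The edge \<open>f\<close> is left out because adjacency provides circles only for distinct
    edges.\<close>
  then have "\<forall>h\<in>E. b \<in> ends h \<longrightarrow> h \<noteq> f \<longrightarrow> concyclic f h"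
  proof (induction rule: rtranclp_induct)
    case base
    then show ?case using block_adjacent_concyclic[OF block f a] by blast
  next
    case (step y z)
    then obtain k where k: "k \<in> E" "ends k = {y, z}" by blast
    show ?case
    proof (intro ballI impI)
      fix h assume h: "h \<in> E" "z \<in> ends h" "h \<noteq> f"
      show "concyclic f h"
      proof (cases "k = f \<or> k = h")
        case True
        then show ?thesis
          using block_adjacent_concyclic[OF block f, of z h] h k step.IH by auto
      next
        case False
        then have "concyclic f k" using step.IH k by auto
        moreover have "concyclic k h" using block_adjacent_concyclic[OF block k(1), of z h] h k False by auto
        ultimately show ?thesis by (rule concyclic_trans)
      qed
    qed
  qed
  then show ?thesis using g b \<open>f \<noteq> g\<close> by blast
qed

text \<open>A smallest edge set joining all pairs of \<open>K\<close> is a forest: if it contained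
  an even set \<open>Z\<close> with an edge \<open>f\<close>, adding \<open>Z\<close> to any joining
  set through \<open>f\<close> would remove \<open>f\<close>, so \<open>f\<close> could be
  dropped.\<close>

lemma spanning_forest:
  assumes "connected_sub ends K H" "H \<subseteq> E"
  obtains M where "M \<subseteq> H" "forest ends M"
    "\<And>u v. u \<in> K \<Longrightarrow> v \<in> K \<Longrightarrow> \<exists>X\<subseteq>M. bnd X = sym_diff {u} {v}"
proof -
  let ?P = "\<lambda>M. M \<subseteq> H \<and> (\<forall>u\<in>K. \<forall>v\<in>K. \<exists>X\<subseteq>M. bnd X = sym_diff {u} {v})"
  have "?P H" using assms reach_imp_bnd[of H] by (auto simp: connected_sub_def)
  then obtain M where M: "?P M" "\<And>N. ?P N \<Longrightarrow> card M \<le> card N"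
    using ex_has_least_nat[of ?P H card] by auto
  have ME: "M \<subseteq> E" using M(1) assms by blast
  have "forest ends M" unfolding forest_def
  proof (intro allI impI, rule ccontr)
    fix Z assume Z: "Z \<subseteq> M" "bnd Z = {}" "Z \<noteq> {}"
    then obtain f where f: "f \<in> Z" by blast
    have "\<exists>X\<subseteq>M - {f}. bnd X = sym_diff {u} {v}" if uv: "u \<in> K" "v \<in> K" for u v
    proof -
      obtain X where X: "X \<subseteq> M" "bnd X = sym_diff {u} {v}" using M(1) uv by blast
      show ?thesis
      proof (cases "f \<in> X")
        case True
        have "bnd (sym_diff X Z) = sym_diff {u} {v}" using bnd_sym_diff[of X Z] X Z ME by auto
        moreover have "sym_diff X Z \<subseteq> M - {f}" using X Z f True by auto
        ultimately show ?thesis by blast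
      next
        case False
        then show ?thesis using X by blast
      qed
    qed
    then have "?P (M - {f})" using M(1) by auto
    then have "card M \<le> card (M - {f})" by (rule M(2))
    moreover have "card (M - {f}) < card M" using f Z ME finite_sub by (intro psubset_card_mono) auto
    ultimately show False by simp
  qed
  then show ?thesis by (intro that[of M]) (use M(1) in auto)
qed

text \<open>Along the list, the edge of least index in a nonempty \<open>X\<close> is the only edge
  of \<open>X\<close> at its first vertex, which is therefore odd.\<close>

lemma is_path_forest:
  assumes "is_path ends (W, F)" "F \<subseteq> E"
  shows "forest ends F"
proof -
  obtain vs where vs: "distinct vs" "length vs = card F + 1"
    "\<And>i. i + 1 < length vs \<Longrightarrow> \<exists>f\<in>F. ends f = {vs ! i, vs ! (i + 1)}"
    using assms(1) by (auto simp: is_path_def)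
  obtain g where g: "\<And>i. i < card F \<Longrightarrow> g i \<in> F \<and> ends (g i) = {vs ! i, vs ! (i + 1)}"
    using vs(2,3) by (metis add_less_cancel_right)
  have idx: "i = j" if "i < card F" "j < card F" "vs ! i \<in> ends (g j)" "j \<ge> i" for i j
  proof -
    have "vs ! i = vs ! j \<or> vs ! i = vs ! (j + 1)" using g[OF that(2)] that(3) by auto
    then show ?thesis using nth_eq_iff_index_eq[OF vs(1)] vs(2) that by auto
  qed
  have inj: "inj_on g {..<card F}"
  proof (rule linorder_inj_onI)
    fix i j :: nat assume ij: "i < j" "i \<in> {..<card F}" "j \<in> {..<card F}"
    then show "g i \<noteq> g j" using idx[of i j] g[of i] by (metis insertI1 lessThan_iff less_imp_le nat_neq_iff)
  qed auto
  \<comment> \<open>The count \<open>length vs = card F + 1\<close> is what makes the edges between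
    consecutive vertices exhaust \<open>F\<close>.\<close>
  have "g ` {..<card F} = F"
    using inj g finite_sub[OF assms(2)] by (intro card_subset_eq) (auto simp: card_image)
  show ?thesis unfolding forest_def
  proof (intro allI impI, rule ccontr)
    fix X assume X: "X \<subseteq> F" "bnd X = {}" "X \<noteq> {}"
    then obtain f where "f \<in> X" by blast
    then have "f \<in> g ` {..<card F}" using \<open>g ` {..<card F} = F\<close> X(1) by auto
    then obtain k where "k < card F \<and> g k \<in> X" using \<open>f \<in> X\<close> by auto
    then obtain i where i: "i < card F \<and> g i \<in> X" "\<And>j. j < card F \<and> g j \<in> X \<Longrightarrow> i \<le> j"
      using exists_least_iff[of "\<lambda>k. k < card F \<and> g k \<in> X"] by (metis not_less)
    have "h = g i" if h: "h \<in> X" "vs ! i \<in> ends h" for h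
    proof -
      have "h \<in> g ` {..<card F}" using \<open>g ` {..<card F} = F\<close> X(1) h(1) by auto
      then obtain j where "j < card F" "h = g j" by auto
      then show ?thesis using idx[of i j] i h by blast
    qed
    then have "vs ! i \<in> bnd X \<longleftrightarrow> vs ! i \<in> bnd {g i}" using i(1) by (intro bnd_cong) auto
    then show False using X g[of i] i assms(2) by (auto simp: bnd_single subset_iff)
  qed
qed

text \<open>Peel off the unique edge at \<open>a\<close>: its far end replaces \<open>a\<close> in
  the boundary. Recording \<open>vs ! 0 = a\<close> allows the list of the remaining forest to be
  extended at the front.\<close>

lemma forest_path_list:
  assumes "forest ends P" "P \<subseteq> E" "bnd P = {a, b}" "a \<noteq> b"
  shows "\<exists>vs. distinct vs \<and> set vs = verts ends P \<and> length vs = card P + 1 \<and> vs ! 0 = a \<and>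
     (\<forall>i. i + 1 < length vs \<longrightarrow> (\<exists>f\<in>P. ends f = {vs ! i, vs ! (i + 1)}))"
  using assms
proof (induction "card P" arbitrary: P a rule: less_induct)
  case less
  obtain g where g: "g \<in> P" "{f\<in>P. a \<in> ends f} = {g}" using forest_end_edge[OF less.prems] by blast
  have fin: "finite P" using less.prems finite_sub by blast
  have gE: "g \<in> E" using g less.prems by blast
  have "a \<in> ends g" using g by blast
  then obtain w where w: "w \<noteq> a" "ends g = {a, w}" using other_end[OF gE] by blast
  have bP: "bnd (P - {g}) = sym_diff {a, b} {a, w}"
    using bnd_Diff[of P "{g}"] less.prems(2,3) g(1) gE w by (simp add: bnd_single)
  show ?case
  proof (cases "w = b")
    case True
    then have "P - {g} = {}" using bP forestD[OF less.prems(1), of "P - {g}"] by auto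
    then have "P = {g}" using g(1) by blast
    then show ?thesis using w True by (intro exI[of _ "[a, b]"]) (auto simp: verts_def)
  next
    case False
    have "card (P - {g}) < card P" using g(1) fin by (intro psubset_card_mono) auto
    moreover have "forest ends (P - {g})" using forest_subset[OF less.prems(1)] by blast
    moreover have "bnd (P - {g}) = {w, b}" using bP w False less.prems(4) by auto
    ultimately obtain vs where vs: "distinct vs" "set vs = verts ends (P - {g})"
      "length vs = card (P - {g}) + 1" "vs ! 0 = w"
      "\<And>i. i + 1 < length vs \<Longrightarrow> \<exists>f\<in>P - {g}. ends f = {vs ! i, vs ! (i + 1)}"
      using less.hyps[of "P - {g}" w] less.prems(2) False by blast
    have "a \<notin> set vs" using g vs(2) by (auto simp: verts_def)
    moreover have "w \<in> set vs" using vs(3,4) by (metis nth_mem zero_less_Suc Suc_eq_plus1)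
    then have "set (a # vs) = verts ends P" using vs(2) g(1) w by (auto simp: verts_def)
    moreover have "card P = Suc (card (P - {g}))" using card.remove[OF fin g(1)] .
    moreover have "\<exists>f\<in>P. ends f = {(a # vs) ! i, (a # vs) ! (i + 1)}" if i: "i + 1 < length (a # vs)" for i
    proof (cases i)
      case 0
      then show ?thesis using g(1) w vs(4) by auto
    next
      case (Suc j)
      then show ?thesis using vs(5)[of j] i by auto
    qed
    ultimately show ?thesis using vs(1,3) by (intro exI[of _ "a # vs"]) auto
  qed
qed

lemma forest_is_path:
  assumes "forest ends P" "P \<subseteq> E" "card (bnd P) = 2"
  shows "is_path ends (verts ends P, P)"
proof -
  obtain a b where "bnd P = {a, b}" "a \<noteq> b" using assms(3) by (auto simp: card_2_iff)
  then show ?thesis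
    using forest_path_list[OF assms(1,2), of a b] finite_sub[OF assms(2)]
    unfolding is_path_def fst_conv snd_conv by blast
qed

end

section \<open>Ears and arcs\<close>

locale battery = multigraph V E ends
  for V :: "'v set" and E :: "'e set" and ends :: "'e \<Rightarrow> 'v set" +
  fixes sigma :: "'e \<Rightarrow> int" and e :: 'e and C :: "'e set"
  assumes signature: "signature E sigma"
    and block: "is_block V E ends"
    and battery: "battery_circle E ends sigma e C"
begin

lemma circle_C: "is_circle E ends C" and e_in_C: "e \<in> C" and prod_C: "prod sigma C = 1"
  using battery by (auto simp: battery_circle_def positive_def)

lemmas C_sub_E = circleD(2)[OF circle_C]
lemmas bnd_C = circleD(3)[OF circle_C]
lemmas even_sub_C = circleD(4)[OF circle_C]

lemma prod_sigma_cases: "X \<subseteq> E \<Longrightarrow> prod sigma X = 1 \<or> prod sigma X = -1"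
proof -
  assume "X \<subseteq> E"
  then have "prod sigma X * prod sigma X = (\<Prod>x\<in>X. sigma x * sigma x)" by (simp add: prod.distrib)
  also have "\<dots> = 1" using signature \<open>X \<subseteq> E\<close> by (intro prod.neutral) (fastforce simp: signature_def)
  finally show ?thesis by (auto simp: zmult_eq_1_iff)
qed

lemma prod_sigma_sym_diff:
  assumes "X \<subseteq> E" "Y \<subseteq> E"
  shows "prod sigma (sym_diff X Y) = prod sigma X * prod sigma Y"
proof -
  have fin: "finite X" "finite Y" using assms finite_sub by auto
  have "prod sigma X = prod sigma (X - Y) * prod sigma (X \<inter> Y)"
    using prod.Int_Diff[OF fin(1), of sigma Y] by (simp add: mult.commute)
  moreover have "prod sigma Y = prod sigma (Y - X) * prod sigma (X \<inter> Y)"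
    using prod.Int_Diff[OF fin(2), of sigma X] by (simp add: mult.commute Int_commute)
  moreover have "prod sigma (sym_diff X Y) = prod sigma (X - Y) * prod sigma (Y - X)"
    using fin by (intro prod.union_disjoint) auto
  moreover have "prod sigma (X \<inter> Y) * prod sigma (X \<inter> Y) = 1"
    using prod_sigma_cases[of "X \<inter> Y", OF le_infI1[OF assms(1)]] by auto
  ultimately show ?thesis by (simp add: algebra_simps)
qed

lemma prod_circle_through_e:
  assumes "is_circle E ends Z" "e \<in> Z" "Z \<noteq> C"
  shows "prod sigma Z = -1"
  using assms battery prod_sigma_cases[OF circleD(2)[OF assms(1)]]
  by (auto simp: battery_circle_def positive_def)

text \<open>Complementing inside the even set \<open>C\<close> preserves the boundary, so of the two
  arcs between the vertices of \<open>A\<close> the one through \<open>e\<close> can be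
  chosen.\<close>

lemma arc_exists:
  assumes "A \<subseteq> verts ends C" "card A = 2"
  obtains Q where "Q \<subseteq> C" "e \<in> Q" "bnd Q = A"
proof -
  obtain a b where ab: "A = {a, b}" "a \<noteq> b" using assms(2) by (auto simp: card_2_iff)
  have "(\<lambda>x y. \<exists>f\<in>C. ends f = {x, y})\<^sup>*\<^sup>* a b"
    using circle_C ab assms(1) by (auto simp: is_circle_def connected_sub_def)
  then obtain X where X: "X \<subseteq> C" "bnd X = sym_diff {a} {b}" using reach_imp_bnd[of C a b] C_sub_E by auto
  have bX: "bnd X = A" using X ab by auto
  show ?thesis
  proof (cases "e \<in> X")
    case True
    then show ?thesis using that X bX by blast
  next
    case False
    moreover have "bnd (C - X) = A" using bnd_Diff[OF C_sub_E X(1)] bnd_C bX by auto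
    ultimately show ?thesis using that[of "C - X"] e_in_C by blast
  qed
qed

text \<open>The sum of \<open>X\<close> and \<open>Q\<close> is an even subset of \<open>C\<close>,
  hence empty or all of \<open>C\<close>.\<close>

lemma arc_unique:
  assumes "X \<subseteq> C" "Q \<subseteq> C" "bnd X = bnd Q"
  shows "X = Q \<or> X = C - Q"
proof -
  have "bnd (sym_diff X Q) = {}" using bnd_sym_diff[of X Q] assms C_sub_E by auto
  then have "sym_diff X Q = {} \<or> sym_diff X Q = C" using even_sub_C[of "sym_diff X Q"] assms by blast
  then show ?thesis using assms by blast
qed

text \<open>Split an even subset into its parts in \<open>P\<close> and in \<open>Q\<close>. They
  have the same boundary, which lies in \<open>A\<close> because \<open>P\<close> meets
  \<open>C\<close> only there. If it is empty both parts are empty, and if it is \<open>A\<close>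
  both are full, since \<open>P\<close> and \<open>Q\<close> are forests.\<close>

lemma ear_arc_circle:
  assumes P: "P \<subseteq> E" "P \<inter> C = {}" "forest ends P" "bnd P = A" "verts ends P \<inter> verts ends C \<subseteq> A"
    and A: "card A = 2" and Q: "Q \<subseteq> C" "bnd Q = A"
  shows "is_circle E ends (P \<union> Q)"
proof -
  have QE: "Q \<subseteq> E" using Q C_sub_E by blast
  have "A \<noteq> {}" using A by auto
  then have "Q \<noteq> C" using Q(2) bnd_C by auto
  then have Qf: "forest ends Q" using circle_proper_forest[OF circle_C] Q(1) by blast
  have "X = {} \<or> X = P \<union> Q" if X: "X \<subseteq> P \<union> Q" "bnd X = {}" for X
  proof -
    have XPE: "X \<inter> P \<subseteq> E" "X \<inter> Q \<subseteq> E" using P QE by auto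
    have "X = (X \<inter> P) \<union> (X \<inter> Q)" using X by blast
    then have "bnd X = sym_diff (bnd (X \<inter> P)) (bnd (X \<inter> Q))"
      using bnd_Un[OF XPE] P(2) Q(1) by (metis (no_types, lifting) Int_assoc Int_left_commute inf.absorb_iff2 Int_empty_right Int_commute)
    then have eq: "bnd (X \<inter> P) = bnd (X \<inter> Q)" using X(2) by blast
    have "bnd (X \<inter> P) \<subseteq> A"
    proof
      fix v assume "v \<in> bnd (X \<inter> P)"
      then have "v \<in> verts ends (X \<inter> P)" "v \<in> verts ends (X \<inter> Q)"
        using eq bnd_subset_verts by blast+
      then show "v \<in> A" using P(5) Q(1) by (auto simp: verts_def)
    qed
    then consider "bnd (X \<inter> P) = {}" | "bnd (X \<inter> P) = A" using bnd_subset_pair[OF XPE(1) _ A] by blast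
    then show ?thesis
    proof cases
      case 1
      then have "X \<inter> P = {}" "X \<inter> Q = {}" using forestD[OF P(3), of "X \<inter> P"] forestD[OF Qf, of "X \<inter> Q"] eq by auto
      then show ?thesis using X(1) by blast
    next
      case 2
      then have "X \<inter> P = P" "X \<inter> Q = Q"
        using forest_unique[OF P(3,1), of "X \<inter> P" P] forest_unique[OF Qf QE, of "X \<inter> Q" Q] P(4) Q(2) eq by auto
      then show ?thesis using X(1) by blast
    qed
  qed
  moreover have "bnd (P \<union> Q) = {}" using bnd_Un[OF P(1) QE] P(2,4) Q by auto
  moreover have "P \<noteq> {}" using P(4) \<open>A \<noteq> {}\<close> by auto
  ultimately show ?thesis unfolding circle_iff_min_even using P(1) QE by auto
qed

lemma prod_ear_arc:
  assumes P: "P \<subseteq> E" "P \<inter> C = {}" "forest ends P" "bnd P = A" "verts ends P \<inter> verts ends C \<subseteq> A"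
    and A: "card A = 2" and Q: "Q \<subseteq> C" "bnd Q = A" "e \<in> Q"
  shows "prod sigma (P \<union> Q) = -1"
proof -
  have "P \<noteq> {}" using P(4) A by auto
  then show ?thesis
    using prod_circle_through_e[OF ear_arc_circle[OF P A Q(1,2)]] P(2) Q(3) by blast
qed

definition attach :: "'e set \<Rightarrow> 'v set" where
  "attach F = verts ends F \<inter> verts ends C"

text \<open>Treats chords and component bridges uniformly as edge sets. The last clause makes a
  vertex off \<open>C\<close> interior: the bridge owns every edge there. That every bridge
  satisfies the count of attachments is established in \<open>bridges_bridge_edges\<close>.\<close>

definition bridge_edges :: "'e set \<Rightarrow> bool" where
  "bridge_edges F \<longleftrightarrow> F \<subseteq> E \<and> F \<inter> C = {} \<and> card (attach F) = 2 \<and>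
     (\<forall>f\<in>F. \<forall>v\<in>ends f - verts ends C. \<forall>g\<in>E. v \<in> ends g \<longrightarrow> g \<in> F)"

text \<open>With two attachments such a forest is the edge set of a path joining them
  (\<open>forest_is_path\<close>).\<close>

definition ear :: "'e set \<Rightarrow> 'e set \<Rightarrow> bool" where
  "ear F P \<longleftrightarrow> P \<subseteq> F \<and> forest ends P \<and> bnd P = attach F"

lemma bridge_edgesD:
  assumes "bridge_edges F"
  shows "F \<subseteq> E" "F \<inter> C = {}" "card (attach F) = 2" "attach F \<noteq> {}" "attach F \<subseteq> verts ends C" "F \<noteq> {}"
  using assms by (auto simp: bridge_edges_def attach_def verts_def)

lemma earD:
  assumes "bridge_edges F" "ear F P"
  shows "P \<subseteq> E" "P \<inter> C = {}" "forest ends P" "bnd P = attach F"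
    "verts ends P \<inter> verts ends C \<subseteq> attach F" "P \<noteq> {}" "P \<subseteq> F"
  using assms bridge_edgesD[OF assms(1)] by (auto simp: ear_def attach_def verts_def)

text \<open>At a vertex of the bridge off \<open>C\<close>, the sets \<open>X\<close> and
  \<open>X \<inter> F\<close> have the same edges, so only attachments can be odd; parity does the
  rest.\<close>

lemma bnd_inter_bridge:
  assumes F: "bridge_edges F" and X: "X \<subseteq> E" "bnd X = {}"
  shows "bnd (X \<inter> F) = {} \<or> bnd (X \<inter> F) = attach F"
proof (rule bnd_subset_pair)
  show "bnd (X \<inter> F) \<subseteq> attach F"
  proof
    fix v assume v: "v \<in> bnd (X \<inter> F)"
    then have "v \<in> verts ends (X \<inter> F)" using bnd_subset_verts by blast
    then have vF: "v \<in> verts ends F" by (auto simp: verts_def)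
    have "v \<in> verts ends C"
    proof (rule ccontr)
      assume "v \<notin> verts ends C"
      then have "\<And>g. g \<in> E \<Longrightarrow> v \<in> ends g \<Longrightarrow> g \<in> F" using F vF by (auto simp: bridge_edges_def verts_def)
      then have "v \<in> bnd (X \<inter> F) \<longleftrightarrow> v \<in> bnd X" using X(1) by (intro bnd_cong) auto
      then show False using v X(2) by simp
    qed
    then show "v \<in> attach F" using vF by (simp add: attach_def)
  qed
qed (use bridge_edgesD[OF F] X in auto)

lemma inter_ear:
  assumes F: "bridge_edges F" and P: "ear F P" and X: "X \<subseteq> E" "bnd X = {}" "X \<inter> F \<subseteq> P"
  shows "X \<inter> F = {} \<or> X \<inter> F = P"
  using bnd_inter_bridge[OF F X(1,2)]
proof
  assume "bnd (X \<inter> F) = {}"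
  then show ?thesis using forestD[OF earD(3)[OF F P] X(3)] by simp
next
  assume "bnd (X \<inter> F) = attach F"
  then show ?thesis
    using forest_unique[OF earD(3,1)[OF F P] X(3) subset_refl] earD(4)[OF F P] by simp
qed

text \<open>The block supplies a circle through \<open>f\<close> and \<open>e\<close>. Its part in
  \<open>F\<close> contains \<open>f\<close> but not \<open>e\<close>, so it is a proper part of a
  circle: a forest with nonempty boundary.\<close>

lemma ear_through:
  assumes F: "bridge_edges F" and f: "f \<in> F"
  obtains P where "ear F P" "f \<in> P"
proof -
  have "f \<noteq> e" "f \<in> E" using f bridge_edgesD[OF F] e_in_C by auto
  then obtain Z where Z: "is_circle E ends Z" "f \<in> Z" "e \<in> Z"
    using block_concyclic[OF block, of f e] e_in_C C_sub_E by (auto simp: concyclic_def)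
  have "e \<notin> F" using bridge_edgesD[OF F] e_in_C by auto
  then have proper: "Z \<inter> F \<subset> Z" using Z by blast
  have "bnd (Z \<inter> F) \<noteq> {}" using circleD(4)[OF Z(1), of "Z \<inter> F"] proper Z f by auto
  then have "bnd (Z \<inter> F) = attach F" using bnd_inter_bridge[OF F circleD(2,3)[OF Z(1)]] by blast
  then have "ear F (Z \<inter> F)" using circle_proper_forest[OF Z(1) proper] by (auto simp: ear_def)
  then show ?thesis using that Z f by blast
qed

text \<open>A smallest subset with the given boundary is a forest, since removing an even part would
  not change the boundary.\<close>

lemma ear_within:
  assumes F: "bridge_edges F" and X: "X \<subseteq> F" "bnd X = attach F"
  obtains P where "ear F P" "P \<subseteq> X"
proof -
  let ?P = "\<lambda>Y. Y \<subseteq> X \<and> bnd Y = attach F"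
  obtain Y where Y: "?P Y" "\<And>Z. ?P Z \<Longrightarrow> card Y \<le> card Z"
    using ex_has_least_nat[of ?P X card] X by auto
  have YE: "Y \<subseteq> E" using Y X bridge_edgesD[OF F] by blast
  have "forest ends Y" unfolding forest_def
  proof (intro allI impI)
    fix Z assume Z: "Z \<subseteq> Y" "bnd Z = {}"
    then have "?P (Y - Z)" using bnd_Diff[OF YE Z(1)] Y(1) by auto
    then have "card Y \<le> card (Y - Z)" by (rule Y(2))
    then have "Y - Z = Y" using card_seteq[OF finite_sub[OF YE], of "Y - Z"] by blast
    then show "Z = {}" using Z by blast
  qed
  then show ?thesis using that[of Y] Y X by (auto simp: ear_def)
qed

text \<open>Every edge lies in some ear, and inside a forest all ears coincide.\<close>

lemma forest_bridge_ear:
  assumes F: "bridge_edges F" "forest ends F"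
  shows "ear F F"
proof -
  obtain f where "f \<in> F" using bridge_edgesD[OF F(1)] by blast
  then obtain P where P: "ear F P" using ear_through[OF F(1)] by blast
  have "F \<subseteq> P"
  proof
    fix g assume "g \<in> F"
    then obtain P' where P': "ear F P'" "g \<in> P'" using ear_through[OF F(1)] by blast
    have "P' = P"
      using forest_unique[OF F(2) bridge_edgesD(1)[OF F(1)], of P' P] P P'(1) by (auto simp: ear_def)
    then show "g \<in> P" using P' by simp
  qed
  then show ?thesis using P by (auto simp: ear_def)
qed

lemma non_forest_two_ears:
  assumes F: "bridge_edges F" "\<not> forest ends F" and P: "ear F P"
  obtains P' where "ear F P'" "P' \<noteq> P"
proof -
  have "P \<noteq> F" using P F(2) by (auto simp: ear_def)
  then obtain g where g: "g \<in> F" "g \<notin> P" using P by (auto simp: ear_def)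
  then show ?thesis using ear_through[OF F(1) g(1)] that by blast
qed

text \<open>Among ears avoiding \<open>f\<close> choose \<open>R\<close> with
  \<open>P \<union> R\<close> smallest; then the sum of \<open>P\<close> and \<open>R\<close> is
  itself a circle. Closing both ears with the same arc through \<open>e\<close> gives two negative
  circles with this sum, which is therefore positive.\<close>

lemma two_ears_positive_circle:
  assumes F: "bridge_edges F" and P: "ear F P" "f \<in> P" and P0: "ear F P0" "f \<notin> P0"
  obtains Z where "is_circle E ends Z" "positive sigma Z" "f \<in> Z" "Z \<subseteq> F"
proof -
  let ?T = "\<lambda>R. ear F R \<and> f \<notin> R"
  obtain R where R: "ear F R" "f \<notin> R" "\<And>S. ?T S \<Longrightarrow> card (P \<union> R) \<le> card (P \<union> S)"
    using ex_has_least_nat[of ?T P0 "\<lambda>R. card (P \<union> R)"] P0 by auto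
  note PD = earD[OF F P(1)] and RD = earD[OF F R(1)]
  let ?Z = "sym_diff P R"
  have ZE: "?Z \<subseteq> E" using PD RD by blast
  have bZ: "bnd ?Z = {}" using bnd_sym_diff[OF PD(1) RD(1)] PD RD by auto
  obtain X where X: "is_circle E ends X" "f \<in> X" "X \<subseteq> ?Z"
    using even_contains_circle[OF ZE bZ, of f] P R by blast
  note XE = circleD(2)[OF X(1)] and bX = circleD(3)[OF X(1)]
  have "bnd (sym_diff P X) = attach F" using bnd_sym_diff[OF PD(1) XE] bX PD(4) by auto
  moreover have "sym_diff P X \<subseteq> F" using X(3) PD(7) RD(7) by blast
  ultimately obtain S where S: "ear F S" "S \<subseteq> sym_diff P X" using ear_within[OF F] by blast
  have "f \<notin> S" using S X P by blast
  then have "card (P \<union> R) \<le> card (P \<union> S)" using R(3) S by blast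
  moreover have "P \<union> S \<subseteq> P \<union> R" using S X by blast
  \<comment> \<open>The ear \<open>S\<close> competes with \<open>R\<close>. Equality puts
    \<open>R - P\<close> inside \<open>S\<close>, hence inside \<open>X\<close>, so what
    \<open>X\<close> leaves of the sum is an even subset of the forest \<open>P\<close>.\<close>
  ultimately have "P \<union> S = P \<union> R" using card_seteq[of "P \<union> R" "P \<union> S"] finite_sub PD RD by blast
  then have "?Z - X \<subseteq> P" using S X by blast
  moreover have "bnd (?Z - X) = {}" using bnd_Diff[OF ZE X(3)] bZ bX by auto
  ultimately have "?Z - X = {}" using forestD[OF PD(3)] by blast
  then have XZ: "X = ?Z" using X by blast
  obtain Q where Q: "Q \<subseteq> C" "e \<in> Q" "bnd Q = attach F" using arc_exists bridge_edgesD(3,5)[OF F] by blast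
  have "prod sigma (P \<union> Q) = -1" "prod sigma (R \<union> Q) = -1"
    using prod_ear_arc[OF PD(1-5) bridge_edgesD(3)[OF F] Q(1,3,2)]
      prod_ear_arc[OF RD(1-5) bridge_edgesD(3)[OF F] Q(1,3,2)] by auto
  moreover have "sym_diff (P \<union> Q) (R \<union> Q) = ?Z" using PD(2) RD(2) Q(1) by blast
  moreover have "Q \<subseteq> E" using Q(1) C_sub_E by blast
  ultimately have "prod sigma ?Z = 1"
    using prod_sigma_sym_diff[of "P \<union> Q" "R \<union> Q"] PD(1) RD(1) by auto
  then have "positive sigma X" using XZ by (simp add: positive_def)
  then show ?thesis using that X PD(7) RD(7) by blast
qed

end

section \<open>Positive circles through two bridges, and the two cases of the theorem for abstract
  bridges\<close>

context battery
begin

text \<open>The union is even, so failing to be a circle it has a proper nonempty even part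
  \<open>X\<close>. This part meets each bridge in nothing or in its whole ear. As \<open>R\<close>
  has no nonempty even subset, \<open>X\<close> takes exactly one of the two ears; then
  \<open>X\<close> or its complement consists of \<open>P1\<close> and a part of \<open>R\<close>
  closing it.\<close>

lemma non_circle_split:
  assumes F: "bridge_edges F1" "bridge_edges F2" "F1 \<inter> F2 = {}" and P: "ear F1 P1" "ear F2 P2"
    and R: "R \<subset> C" "bnd R = sym_diff (attach F1) (attach F2)"
    and nc: "\<not> is_circle E ends (P1 \<union> P2 \<union> R)"
  obtains Y where "Y \<subseteq> R" "bnd Y = attach F1"
proof -
  note P1 = earD[OF F(1) P(1)] and P2 = earD[OF F(2) P(2)]
  note F1 = bridge_edgesD[OF F(1)] and F2 = bridge_edgesD[OF F(2)]
  let ?U = "P1 \<union> P2 \<union> R"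
  have RE: "R \<subseteq> E" using R C_sub_E by blast
  have UE: "?U \<subseteq> E" using P1 P2 RE by blast
  have "P1 \<inter> P2 = {}" using P1(7) P2(7) F(3) by blast
  then have "bnd (P1 \<union> P2) = sym_diff (attach F1) (attach F2)"
    using bnd_Un[OF P1(1) P2(1)] P1(4) P2(4) by simp
  moreover have "bnd ?U = sym_diff (bnd (P1 \<union> P2)) (bnd R)"
    using P1(1,2) P2(1,2) R(1) RE by (intro bnd_Un) auto
  ultimately have bU: "bnd ?U = {}" using R(2) by auto
  obtain X where X: "X \<subseteq> ?U" "bnd X = {}" "X \<noteq> {}" "X \<noteq> ?U"
    using nc UE bU P1(6) unfolding circle_iff_min_even by blast
  have even_R: "Z = {}" if "Z \<subseteq> R" "bnd Z = {}" for Z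
    using even_sub_C[of Z] that R(1) by blast
  have XE: "X \<subseteq> E" using X UE by blast
  have bUX: "bnd (?U - X) = {}" using bnd_Diff[OF UE X(1)] bU X(2) by auto
  have arc: "\<exists>Y\<subseteq>R. bnd Y = attach F1" if Z: "Z \<subseteq> ?U" "bnd Z = {}" "Z \<inter> F1 = P1" "Z \<inter> F2 = {}" for Z
  proof -
    have "Z = P1 \<union> (Z \<inter> R)" using Z(1,3,4) P2(7) by blast
    moreover have "bnd (P1 \<union> (Z \<inter> R)) = sym_diff (bnd P1) (bnd (Z \<inter> R))"
      using P1(1,2) RE R(1) by (intro bnd_Un) auto
    ultimately have "sym_diff (attach F1) (bnd (Z \<inter> R)) = {}" using Z(2) P1(4) by simp
    then have "bnd (Z \<inter> R) = attach F1" by blast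
    then show ?thesis by blast
  qed
  have sub: "X \<inter> F1 \<subseteq> P1" "X \<inter> F2 \<subseteq> P2"
    using X(1) P1(7) P2(7) F(3) R(1) F1(2) F2(2) by blast+
  have X1: "X \<inter> F1 = {} \<or> X \<inter> F1 = P1" using inter_ear[OF F(1) P(1) XE X(2) sub(1)] .
  have X2: "X \<inter> F2 = {} \<or> X \<inter> F2 = P2" using inter_ear[OF F(2) P(2) XE X(2) sub(2)] .
  have PR: "P1 \<inter> R = {}" "P2 \<inter> R = {}" "R \<inter> F1 = {}" "R \<inter> F2 = {}" "P1 \<inter> F2 = {}" "P2 \<inter> F1 = {}"
    using P1(2,7) P2(2,7) R(1) F(3) F1(2) F2(2) by blast+
  consider "X \<inter> F1 = {}" "X \<inter> F2 = {}" | "X \<inter> F1 = P1" "X \<inter> F2 = {}"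
    | "X \<inter> F1 = {}" "X \<inter> F2 = P2" | "X \<inter> F1 = P1" "X \<inter> F2 = P2"
    using X1 X2 by blast
  then have "\<exists>Y\<subseteq>R. bnd Y = attach F1"
  proof cases
    case 1
    then have "X \<subseteq> R" using X(1) P1(7) P2(7) by blast
    then show ?thesis using even_R X by blast
  next
    case 2
    then show ?thesis using arc X by blast
  next
    case 3
    then have "(?U - X) \<inter> F1 = P1" "(?U - X) \<inter> F2 = {}" using P1(7) P2(7) PR by blast+
    then show ?thesis using arc[of "?U - X"] bUX by blast
  next
    case 4
    then have "?U - X \<subseteq> R" by blast
    then have "?U - X = {}" using even_R bUX by blast
    then show ?thesis using X by blast
  qed
  then show ?thesis using that by blast
qed

text \<open>Let \<open>R\<close> be the sum of the arcs through \<open>e\<close> for the two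
  bridges. The sum of the two negative circles is the union of \<open>P1\<close>, \<open>P2\<close>
  and \<open>R\<close>, so its sign is positive. If it were no circle, \<open>R\<close> would
  contain the arc \<open>C - Q1\<close>; applying the same splitting to \<open>C - R\<close> leads
  to a contradiction.\<close>

lemma two_bridges_positive_circle:
  assumes F: "bridge_edges F1" "bridge_edges F2" "F1 \<inter> F2 = {}" and P: "ear F1 P1" "ear F2 P2"
  obtains R where "R \<subseteq> C" "is_circle E ends (P1 \<union> P2 \<union> R)" "positive sigma (P1 \<union> P2 \<union> R)"
proof -
  note P1 = earD[OF F(1) P(1)] and P2 = earD[OF F(2) P(2)]
  note F1 = bridge_edgesD[OF F(1)] and F2 = bridge_edgesD[OF F(2)]
  obtain Q1 where Q1: "Q1 \<subseteq> C" "e \<in> Q1" "bnd Q1 = attach F1" using arc_exists[OF F1(5,3)] by blast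
  obtain Q2 where Q2: "Q2 \<subseteq> C" "e \<in> Q2" "bnd Q2 = attach F2" using arc_exists[OF F2(5,3)] by blast
  have QE: "Q1 \<subseteq> E" "Q2 \<subseteq> E" using Q1 Q2 C_sub_E by auto
  define R where "R = sym_diff Q1 Q2"
  have RC: "R \<subset> C" using Q1 Q2 by (auto simp: R_def)
  have eR: "e \<notin> R" using Q1 Q2 by (auto simp: R_def)
  have bR: "bnd R = sym_diff (attach F1) (attach F2)"
    unfolding R_def using bnd_sym_diff[OF QE] Q1(3) Q2(3) by simp
  have "prod sigma (P1 \<union> Q1) = -1" "prod sigma (P2 \<union> Q2) = -1"
    using prod_ear_arc[OF P1(1-5) F1(3) Q1(1,3,2)] prod_ear_arc[OF P2(1-5) F2(3) Q2(1,3,2)] by auto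
  moreover have "P1 \<inter> P2 = {}" using P1(7) P2(7) F(3) by blast
  then have "sym_diff (P1 \<union> Q1) (P2 \<union> Q2) = P1 \<union> P2 \<union> R"
    using P1(2) P2(2) Q1(1) Q2(1) unfolding R_def by blast
  ultimately have pS: "prod sigma (P1 \<union> P2 \<union> R) = 1"
    using prod_sigma_sym_diff[of "P1 \<union> Q1" "P2 \<union> Q2"] P1(1) P2(1) QE by auto
  have "is_circle E ends (P1 \<union> P2 \<union> R)"
  proof (rule ccontr)
    assume "\<not> is_circle E ends (P1 \<union> P2 \<union> R)"
    then obtain Y where Y: "Y \<subseteq> R" "bnd Y = attach F1"
      using non_circle_split[OF F P RC bR] by blast
    \<comment> \<open>Of the two arcs with this boundary, \<open>Q1\<close> contains
      \<open>e\<close> and \<open>R\<close> does not.\<close>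
    then have "Y = C - Q1" using arc_unique[of Y Q1] RC Q1 eR by blast
    then have Q1R: "C - Q1 \<subseteq> R" using Y by blast
    have "C \<noteq> Q1" using Q1(3) F1(4) bnd_C by auto
    have "bnd (C - R) = sym_diff (attach F1) (attach F2)"
      using bnd_Diff[OF C_sub_E psubset_imp_subset[OF RC]] bnd_C bR by auto
    moreover have CR: "C - R \<subset> C" using Q1R \<open>C \<noteq> Q1\<close> Q1(1) by blast
    \<comment> \<open>This union contains \<open>e\<close>, differs from \<open>C\<close>, and is
      positive because adding \<open>C\<close> does not change the sign.\<close>
    moreover have "\<not> is_circle E ends (P1 \<union> P2 \<union> (C - R))"
    proof
      assume T: "is_circle E ends (P1 \<union> P2 \<union> (C - R))"
      have "P1 \<union> P2 \<union> (C - R) = sym_diff (P1 \<union> P2 \<union> R) C" using P1(2) P2(2) RC by blast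
      then have "prod sigma (P1 \<union> P2 \<union> (C - R)) = 1"
        using prod_sigma_sym_diff[of "P1 \<union> P2 \<union> R" C] P1(1) P2(1) RC C_sub_E pS prod_C by auto
      moreover have "P1 \<union> P2 \<union> (C - R) \<noteq> C" using P1(2,6) by blast
      ultimately show False using prod_circle_through_e[OF T] e_in_C eR by auto
    qed
    ultimately obtain Y' where Y': "Y' \<subseteq> C - R" "bnd Y' = attach F1"
      using non_circle_split[OF F P, of "C - R"] by blast
    then have "Y' = Q1 \<or> Y' = C - Q1" using arc_unique[of Y' Q1] Q1 by blast
    then have "Y' = Q1" using Q1R Y'(1) \<open>C \<noteq> Q1\<close> Q1(1) by blast
    then have "C - R = Q1" using Q1R Y'(1) by blast
    \<comment> \<open>Comparing the boundaries of \<open>C - R\<close> and \<open>Q1\<close> would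
      leave \<open>F2\<close> without attachments.\<close>
    then have "sym_diff (attach F1) (attach F2) = attach F1"
      using \<open>bnd (C - R) = _\<close> Q1(3) by simp
    then show False using F2(4) by blast
  qed
  then show ?thesis using that[of R] RC pS by (auto simp: positive_def)
qed

text \<open>A positive circle through \<open>f\<close> contains all of \<open>F1\<close>. It also
  contains \<open>F2\<close>, for otherwise it would be \<open>F1\<close> closed by an arc of
  \<open>C\<close>, and both closures are negative. Two such circles thus differ only on
  \<open>C\<close>.\<close>

lemma forest_bridges_pos_battery:
  assumes F: "bridge_edges F1" "bridge_edges F2" "F1 \<inter> F2 = {}"
    and forest: "forest ends F1" "forest ends F2" and cover: "E \<subseteq> C \<union> F1 \<union> F2" and f: "f \<in> F1"
  shows "pos_battery E ends sigma f"
proof -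
  note F1 = bridge_edgesD[OF F(1)] and F2 = bridge_edgesD[OF F(2)]
  have ears: "ear F1 F1" "ear F2 F2" using forest_bridge_ear F forest by auto
  obtain R where R: "R \<subseteq> C" "is_circle E ends (F1 \<union> F2 \<union> R)" "positive sigma (F1 \<union> F2 \<union> R)"
    using two_bridges_positive_circle[OF F ears] by blast
  obtain Q where Q: "Q \<subseteq> C" "e \<in> Q" "bnd Q = attach F1" using arc_exists[OF F1(5,3)] by blast
  have QE: "Q \<subseteq> E" using Q C_sub_E by blast
  have FQ: "prod sigma (F1 \<union> Q) = -1"
    using prod_ear_arc[OF earD(1-5)[OF F(1) ears(1)] F1(3) Q(1,3,2)] .
  have inter: "X \<inter> F1 = F1 \<and> X \<inter> F2 = F2"
    if X: "is_circle E ends X" "positive sigma X" "f \<in> X" for X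
  proof -
    note XE = circleD(2)[OF X(1)] and bX = circleD(3)[OF X(1)]
    have X1: "X \<inter> F1 = F1" using inter_ear[OF F(1) ears(1) XE bX] X(3) f by blast
    have "X \<inter> F2 \<noteq> {}"
    proof
      assume "X \<inter> F2 = {}"
      then have X_eq: "X = F1 \<union> (X \<inter> C)" using XE cover X1 by blast
      have "bnd (F1 \<union> (X \<inter> C)) = sym_diff (bnd F1) (bnd (X \<inter> C))"
        using F1 C_sub_E by (intro bnd_Un) auto
      then have "bnd (X \<inter> C) = bnd F1" using X_eq bX by auto
      then have "bnd (X \<inter> C) = bnd Q" using Q(3) earD(4)[OF F(1) ears(1)] by simp
      then have "X \<inter> C = Q \<or> X \<inter> C = C - Q" using arc_unique[of "X \<inter> C" Q] Q by blast
      \<comment> \<open>Exchanging the arc \<open>Q\<close> for its complement adds the positive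
        circle \<open>C\<close>, so both closures have the same sign.\<close>
      then have "X = F1 \<union> Q \<or> X = sym_diff (F1 \<union> Q) C" using X_eq F1(2) Q(1) by blast
      then have "prod sigma X = -1"
        using FQ prod_sigma_sym_diff[of "F1 \<union> Q" C] F1(1) QE C_sub_E prod_C by auto
      then show False using X(2) by (simp add: positive_def)
    qed
    then show ?thesis using X1 inter_ear[OF F(2) ears(2) XE bX] by blast
  qed
  have "X = Y" if X: "is_circle E ends X" "positive sigma X" "f \<in> X"
    and Y: "is_circle E ends Y" "positive sigma Y" "f \<in> Y" for X Y
  proof -
    note XE = circleD(2)[OF X(1)] and YE = circleD(2)[OF Y(1)]
    have "sym_diff X Y \<subseteq> C" using inter[OF X] inter[OF Y] XE YE cover by blast
    moreover have "bnd (sym_diff X Y) = {}"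
      using bnd_sym_diff[OF XE YE] circleD(3)[OF X(1)] circleD(3)[OF Y(1)] by simp
    \<comment> \<open>A positive circle through \<open>f\<close> is not \<open>C\<close>, so it
      avoids \<open>e\<close>; an even subset of \<open>C\<close> without \<open>e\<close> is
      empty.\<close>
    moreover have "e \<notin> sym_diff X Y"
      using prod_circle_through_e[OF X(1)] prod_circle_through_e[OF Y(1)] X Y f F1(2)
      by (auto simp: positive_def)
    ultimately show ?thesis using even_sub_C[of "sym_diff X Y"] e_in_C by blast
  qed
  then show ?thesis unfolding pos_battery_def using R f by blast
qed

text \<open>The circle built from a pair of ears determines both, as its intersections with the
  bridges. Uniqueness of the positive circle through \<open>f\<close> would therefore leave only one
  ear through \<open>f\<close> in \<open>F1\<close> and only one ear in \<open>F2\<close>.\<close>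

lemma non_forest_bridges_not_pos_battery:
  assumes F: "bridge_edges F1" "bridge_edges F2" "F1 \<inter> F2 = {}"
    and nf: "\<not> (forest ends F1 \<and> forest ends F2)" and f: "f \<in> F1"
  shows "\<not> pos_battery E ends sigma f"
proof
  assume pb: "pos_battery E ends sigma f"
  have unique: "X = Y" if "is_circle E ends X" "positive sigma X" "f \<in> X"
    "is_circle E ends Y" "positive sigma Y" "f \<in> Y" for X Y
    using pb that unfolding pos_battery_def by blast
  note F1 = bridge_edgesD[OF F(1)] and F2 = bridge_edgesD[OF F(2)]
  have unique_ears: "P = P' \<and> R = R'"
    if ears: "ear F1 P" "f \<in> P" "ear F2 R" "ear F1 P'" "f \<in> P'" "ear F2 R'" for P R P' R'
  proof -
    obtain T where T: "T \<subseteq> C" "is_circle E ends (P \<union> R \<union> T)" "positive sigma (P \<union> R \<union> T)"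
      using two_bridges_positive_circle[OF F ears(1,3)] by blast
    obtain T' where T': "T' \<subseteq> C" "is_circle E ends (P' \<union> R' \<union> T')" "positive sigma (P' \<union> R' \<union> T')"
      using two_bridges_positive_circle[OF F ears(4,6)] by blast
    have eq: "P \<union> R \<union> T = P' \<union> R' \<union> T'" using unique T T' ears by blast
    have 1: "(P \<union> R \<union> T) \<inter> F1 = P" "(P \<union> R \<union> T) \<inter> F2 = R"
      using earD(7)[OF F(1) ears(1)] earD(7)[OF F(2) ears(3)] T(1) F(3) F1(2) F2(2) by blast+
    have 2: "(P' \<union> R' \<union> T') \<inter> F1 = P'" "(P' \<union> R' \<union> T') \<inter> F2 = R'"
      using earD(7)[OF F(1) ears(4)] earD(7)[OF F(2) ears(6)] T'(1) F(3) F1(2) F2(2) by blast+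
    show ?thesis using 1 2 eq by simp
  qed
  obtain P where P: "ear F1 P" "f \<in> P" using ear_through[OF F(1) f] .
  obtain g where "g \<in> F2" using F2(6) by blast
  then obtain R where R: "ear F2 R" using ear_through[OF F(2)] by blast
  show False
  proof (cases "forest ends F2")
    case False
    then obtain R' where "ear F2 R'" "R' \<noteq> R" using non_forest_two_ears[OF F(2) _ R] by blast
    then show ?thesis using unique_ears[OF P R P] by blast
  next
    case True
    then obtain P' where P': "ear F1 P'" "P' \<noteq> P" using nf non_forest_two_ears[OF F(1) _ P(1)] by blast
    \<comment> \<open>A second ear of \<open>F1\<close> must avoid \<open>f\<close>, so the two ears
      yield a positive circle inside \<open>F1\<close>, unlike the one that also passes through
      \<open>F2\<close>.\<close>
    have "f \<notin> P'" using unique_ears[OF P R P'(1) _ R] P'(2) by blast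
    then obtain Z where Z: "is_circle E ends Z" "positive sigma Z" "f \<in> Z" "Z \<subseteq> F1"
      using two_ears_positive_circle[OF F(1) P P'(1)] by blast
    obtain T where T: "T \<subseteq> C" "is_circle E ends (P \<union> R \<union> T)" "positive sigma (P \<union> R \<union> T)"
      using two_bridges_positive_circle[OF F P(1) R] by blast
    have "Z = P \<union> R \<union> T" using unique[OF Z(1-3) T(2,3)] P(2) by blast
    then show ?thesis using Z(4) earD(6,7)[OF F(2) R] F(3) by blast
  qed
qed

end

section \<open>Bridges with exactly two attachments\<close>

context battery
begin

lemma two_verts_C: "\<exists>c\<in>verts ends C. c \<noteq> a"
proof -
  have "card (ends e) = 2" using card_ends e_in_C C_sub_E by blast
  then obtain x y where "ends e = {x, y}" "x \<noteq> y" by (auto simp: card_2_iff)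
  then have "x \<in> verts ends C" "y \<in> verts ends C" using e_in_C by (auto simp: verts_def)
  then show ?thesis using \<open>x \<noteq> y\<close> by metis
qed

section \<open>The bridge formed by a component of the complement of \<open>C\<close>\<close>

context
  fixes K :: "'v set" and F :: "'e set"
  assumes K: "K \<in> components_off V E ends (verts ends C)"
  defines "F \<equiv> {f\<in>E. ends f \<inter> K \<noteq> {}}"
begin

lemma component_disjoint_C: "K \<inter> verts ends C = {}" and component_sub_V: "K \<subseteq> V"
  using K by (auto simp: components_off_def)

lemma component_end:
  assumes "f \<in> F" "v \<in> ends f" "v \<notin> verts ends C"
  shows "v \<in> K"
proof (rule ccontr)
  assume "v \<notin> K"
  have fE: "f \<in> E" "ends f \<inter> K \<noteq> {}" using assms by (auto simp: F_def)
  obtain w where w: "ends f = {v, w}" using other_end[OF fE(1) assms(2)] by blast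
  then have "w \<in> K" using fE \<open>v \<notin> K\<close> by auto
  then have "ends f \<subseteq> V - verts ends C"
    using w assms(3) component_disjoint_C ends_subset[OF fE(1)] by auto
  then show False using K fE assms(2) \<open>v \<notin> K\<close> by (auto simp: components_off_def)
qed

text \<open>A single-vertex component still meets some edge, because the block is connected and
  \<open>C\<close> has other vertices. Hence the vertex set of the bridge is recovered from its
  edges.\<close>

lemma component_sub_verts: "K \<subseteq> verts ends F"
proof
  fix k assume k: "k \<in> K"
  obtain c where c: "c \<in> verts ends C" "c \<noteq> k" using two_verts_C by blast
  have "c \<in> V" using c ends_subset C_sub_E by (auto simp: verts_def)
  then have reach: "(\<lambda>x y. \<exists>f\<in>E. ends f = {x, y})\<^sup>*\<^sup>* k c"
    using block k component_sub_V by (auto simp: is_block_def connected_sub_def)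
  show "k \<in> verts ends F"
  proof (rule ccontr)
    assume "k \<notin> verts ends F"
    then have "\<And>f. f \<in> E \<Longrightarrow> k \<notin> ends f" using k by (auto simp: F_def verts_def)
    then have "c \<in> {k}" using reach_closed[OF reach, of "{k}"] by auto
    then show False using c by simp
  qed
qed

text \<open>With at most one attachment, some vertex \<open>a\<close> of \<open>C\<close> contains
  them all. Without \<open>a\<close> no edge leaves \<open>K\<close>, yet the block stays connected
  and \<open>C\<close> has a vertex besides \<open>a\<close>.\<close>

lemma component_two_attachments: "2 \<le> card (attach F)"
proof (rule ccontr)
  assume "\<not> 2 \<le> card (attach F)"
  moreover have "verts ends C \<subseteq> V" using ends_subset C_sub_E by (fastforce simp: verts_def)
  then have "finite (attach F)"
    using graph finite_subset[of "attach F" V] by (auto simp: attach_def graph_def)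
  ultimately have one: "\<forall>x\<in>attach F. \<forall>y\<in>attach F. x = y"
    using card_le_Suc0_iff_eq[of "attach F"] by auto
  have "\<exists>a\<in>verts ends C. attach F \<subseteq> {a}"
  proof (cases "attach F = {}")
    case True
    then show ?thesis using two_verts_C by blast
  next
    case False
    then obtain a where "a \<in> attach F" by blast
    then show ?thesis using one by (intro bexI[of _ a]) (auto simp: attach_def)
  qed
  then obtain a where a: "a \<in> verts ends C" "attach F \<subseteq> {a}" by blast
  obtain c where c: "c \<in> verts ends C" "c \<noteq> a" using two_verts_C by blast
  obtain k where k: "k \<in> K" using K by (auto simp: components_off_def)
  have "k \<noteq> a" "k \<in> V" "a \<in> V" "c \<in> V"
    using a c k component_disjoint_C component_sub_V \<open>verts ends C \<subseteq> V\<close> by auto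
  then have "(\<lambda>x y. \<exists>f\<in>{f\<in>E. a \<notin> ends f}. ends f = {x, y})\<^sup>*\<^sup>* k c"
    using block c(2) by (auto simp: is_block_def connected_sub_def)
  then have "c \<in> K"
  proof (rule reach_closed)
    fix f assume f: "f \<in> {f\<in>E. a \<notin> ends f}" "ends f \<inter> K \<noteq> {}"
    then have "f \<in> F" by (auto simp: F_def)
    then have "v \<notin> verts ends C" if "v \<in> ends f" for v
      using a(2) f(1) that by (auto simp: attach_def verts_def)
    then show "ends f \<subseteq> K" using component_end \<open>f \<in> F\<close> by blast
  qed (fact k)
  then show False using c component_disjoint_C by blast
qed

text \<open>If there were three attachments, the three paths joining them inside a spanning tree of the
  component would cancel modulo 2. Closing them with arcs through \<open>e\<close> would give three negative
  circles whose sum is the positive circle \<open>C\<close>.\<close>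

lemma component_no_third_attachment:
  assumes abc: "a \<in> attach F" "b \<in> attach F" "c \<in> attach F" "a \<noteq> b" "b \<noteq> c" "a \<noteq> c"
  shows False
proof -
  let ?H = "{f\<in>E. ends f \<subseteq> K}"
  have "connected_sub ends K ?H" using K by (auto simp: components_off_def)
  then obtain M where M: "M \<subseteq> ?H" "forest ends M"
    "\<And>u v. u \<in> K \<Longrightarrow> v \<in> K \<Longrightarrow> \<exists>X\<subseteq>M. bnd X = sym_diff {u} {v}"
    using spanning_forest[of K ?H] by blast
  have ME: "M \<subseteq> E" using M by blast
  \<comment> \<open>The edge into \<open>K\<close> is chosen per attachment, independently of the
    pair to be joined. Each such edge then occurs in two of the three paths and cancels.\<close>
  have "\<exists>h k. h \<in> F \<and> k \<in> K \<and> ends h = {x, k}" if x: "x \<in> attach F" for x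
  proof -
    obtain h where h: "h \<in> F" "x \<in> ends h" using x by (auto simp: attach_def verts_def)
    then obtain k where k: "ends h = {x, k}" using other_end[of h x] by (auto simp: F_def)
    have "x \<notin> K" using x component_disjoint_C by (auto simp: attach_def)
    then have "k \<in> K" using h k by (auto simp: F_def)
    then show ?thesis using h k by blast
  qed
  then obtain h k where hk: "\<And>x. x \<in> attach F \<Longrightarrow> h x \<in> F \<and> k x \<in> K \<and> ends (h x) = {x, k x}"
    by metis
  have hE: "h x \<in> E" if "x \<in> attach F" for x using hk[OF that] by (auto simp: F_def)
  have aC: "x \<in> verts ends C" "x \<notin> K" if "x \<in> attach F" for x
    using that component_disjoint_C by (auto simp: attach_def)
  have hM: "h x \<notin> M" if "x \<in> attach F" for x using hk[OF that] aC[OF that] M(1) by auto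
  have hh: "h x \<noteq> h y" if xy: "x \<in> attach F" "y \<in> attach F" "x \<noteq> y" for x y
  proof
    assume "h x = h y"
    then have "x \<in> {y, k y}" using hk[OF xy(1)] hk[OF xy(2)] by auto
    then show False using xy hk[OF xy(2)] aC[OF xy(1)] by auto
  qed
  obtain r where r: "\<And>u v. u \<in> K \<Longrightarrow> v \<in> K \<Longrightarrow> r u v \<subseteq> M \<and> bnd (r u v) = sym_diff {u} {v}"
    using M(3) by metis
  define R where "R x y = r (k x) (k y)" for x y
  have R: "R x y \<subseteq> M" "bnd (R x y) = sym_diff {k x} {k y}" if "x \<in> attach F" "y \<in> attach F" for x y
    using r[of "k x" "k y"] hk that by (auto simp: R_def)
  have "\<exists>q. q \<subseteq> C \<and> e \<in> q \<and> bnd q = {x, y}" if "x \<in> attach F" "y \<in> attach F" "x \<noteq> y" for x y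
  proof -
    have "{x, y} \<subseteq> verts ends C" "card {x, y} = 2" using aC that by auto
    then show ?thesis using arc_exists by metis
  qed
  then obtain Q where Q: "\<And>x y. x \<in> attach F \<Longrightarrow> y \<in> attach F \<Longrightarrow> x \<noteq> y \<Longrightarrow>
      Q x y \<subseteq> C \<and> e \<in> Q x y \<and> bnd (Q x y) = {x, y}" by metis
  define P where "P x y = {h x, h y} \<union> R x y" for x y
  have MC: "M \<inter> C = {}"
  proof (rule ccontr)
    assume "M \<inter> C \<noteq> {}"
    then obtain f where f: "f \<in> M" "f \<in> C" by blast
    then have "ends f \<subseteq> K" "ends f \<subseteq> verts ends C" using M(1) by (auto simp: verts_def)
    then have "ends f = {}" using component_disjoint_C by blast
    then show False using card_ends[of f] f ME by auto
  qed
  have hC: "h x \<notin> C" if "x \<in> attach F" for x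
    using hk[OF that] component_disjoint_C by (auto simp: verts_def)
  have neg: "prod sigma (P x y \<union> Q x y) = -1" and PE: "P x y \<union> Q x y \<subseteq> E" and PC: "P x y \<inter> C = {}"
    if xy: "x \<in> attach F" "y \<in> attach F" "x \<noteq> y" for x y
  proof -
    note Rxy = R[OF xy(1,2)] and hx = hk[OF xy(1)] and hy = hk[OF xy(2)]
    have PE': "P x y \<subseteq> E" using Rxy ME hE xy by (auto simp: P_def)
    show "P x y \<union> Q x y \<subseteq> E" using PE' Q[OF xy] C_sub_E by blast
    show PC: "P x y \<inter> C = {}" using Rxy MC hC xy by (auto simp: P_def)
    have "bnd {h x, h y} = sym_diff {x, k x} {y, k y}"
      using bnd_Un[of "{h x}" "{h y}"] hh[OF xy] hE xy hx hy by (simp add: bnd_single insert_commute)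
    moreover have "bnd (P x y) = sym_diff (bnd {h x, h y}) (bnd (R x y))"
      unfolding P_def using hE xy Rxy ME hM by (intro bnd_Un) auto
    ultimately have "bnd (P x y) = sym_diff (sym_diff {x, k x} {y, k y}) (sym_diff {k x} {k y})"
      using Rxy by simp
    also have "\<dots> = {x, y}" using aC xy hx hy by auto
    finally have bP: "bnd (P x y) = {x, y}" .
    have RK: "v \<in> K" if "f \<in> R x y" "v \<in> ends f" for f v using that Rxy M(1) by blast
    have "forest ends (P x y)" unfolding forest_def
    proof (intro allI impI)
      fix X assume X: "X \<subseteq> P x y" "bnd X = {}"
      \<comment> \<open>The edge \<open>h z\<close> is the only edge of \<open>P x y\<close> at
        \<open>z\<close>, so an even subset omits both end edges and falls into the forest
        \<open>M\<close>.\<close>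
      have "z \<in> bnd X" if z: "z = x \<or> z = y" "h z \<in> X" for z
      proof -
        have za: "z \<in> attach F" using z xy by auto
        have "f = h z" if "f \<in> P x y" "z \<in> ends f" for f
          using that RK aC[OF za] hx hy z aC[OF xy(1)] aC[OF xy(2)] xy(3) by (auto simp: P_def)
        then have "z \<in> bnd X \<longleftrightarrow> z \<in> bnd {h z}" using X z by (intro bnd_cong) auto
        then show ?thesis using hk[OF za] hE[OF za] by (auto simp: bnd_single)
      qed
      then have "h x \<notin> X" "h y \<notin> X" using X by auto
      then have "X \<subseteq> M" using X Rxy by (auto simp: P_def)
      then show "X = {}" using forestD[OF M(2)] X by blast
    qed
    moreover have "verts ends (P x y) \<inter> verts ends C \<subseteq> {x, y}"
      using RK hx hy component_disjoint_C by (auto simp: P_def verts_def)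
    ultimately show "prod sigma (P x y \<union> Q x y) = -1"
      using prod_ear_arc[OF PE' PC _ bP] Q[OF xy] xy(3) by auto
  qed
  let ?Yab = "P a b \<union> Q a b" and ?Ybc = "P b c \<union> Q b c" and ?Yac = "P a c \<union> Q a c"
  note ab = abc(1,2,4) and bc = abc(2,3,5) and ac = abc(1,3,6)
  have "prod sigma (sym_diff (sym_diff ?Yab ?Ybc) ?Yac) = -1"
    using prod_sigma_sym_diff[of "sym_diff ?Yab ?Ybc" ?Yac] prod_sigma_sym_diff[OF PE[OF ab] PE[OF bc]]
      neg[OF ab] neg[OF bc] neg[OF ac] PE[OF ab] PE[OF bc] PE[OF ac] by auto
  moreover have "sym_diff (sym_diff ?Yab ?Ybc) ?Yac = C"
  proof -
    let ?Q = "sym_diff (sym_diff (Q a b) (Q b c)) (Q a c)" and ?R = "sym_diff (sym_diff (R a b) (R b c)) (R a c)"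
    have QC: "Q a b \<subseteq> C" "Q b c \<subseteq> C" "Q a c \<subseteq> C" and eQ: "e \<in> Q a b" "e \<in> Q b c" "e \<in> Q a c"
      and bQ: "bnd (Q a b) = {a, b}" "bnd (Q b c) = {b, c}" "bnd (Q a c) = {a, c}"
      using Q[OF ab] Q[OF bc] Q[OF ac] by auto
    have "bnd ?Q = sym_diff (sym_diff {a, b} {b, c}) {a, c}"
      using bnd_sym_diff[of "sym_diff (Q a b) (Q b c)" "Q a c"] bnd_sym_diff[of "Q a b" "Q b c"] QC bQ C_sub_E
      by (simp add: subset_iff)
    also have "\<dots> = {}" using abc(4-6) by auto
    finally have "?Q = {} \<or> ?Q = C" using even_sub_C[of ?Q] QC by blast
    \<comment> \<open>The edge \<open>e\<close> lies in all three arcs, so it survives in their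
      sum.\<close>
    then have "?Q = C" using eQ by blast
    have RM: "R a b \<subseteq> M" "R b c \<subseteq> M" "R a c \<subseteq> M" using R abc by auto
    have "bnd ?R = sym_diff (sym_diff (sym_diff {k a} {k b}) (sym_diff {k b} {k c})) (sym_diff {k a} {k c})"
      using bnd_sym_diff[of "sym_diff (R a b) (R b c)" "R a c"] bnd_sym_diff[of "R a b" "R b c"] RM ME R abc
      by (simp add: subset_iff)
    also have "\<dots> = {}" by auto
    finally have "?R = {}" using forestD[OF M(2), of ?R] RM by blast
    have hs: "h a \<noteq> h b" "h b \<noteq> h c" "h a \<noteq> h c" "h a \<notin> M" "h b \<notin> M" "h c \<notin> M"
      using hh hM abc by auto
    have "{h a, h b, h c} \<inter> (R a b \<union> R b c \<union> R a c) = {}" using RM hs(4-6) by auto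
    then have "sym_diff (sym_diff (P a b) (P b c)) (P a c) = ?R"
      unfolding P_def using hs(1-3) by auto
    moreover have "sym_diff (sym_diff ?Yab ?Ybc) ?Yac = sym_diff (sym_diff (P a b) (P b c)) (P a c) \<union> ?Q"
      using PC[OF ab] PC[OF bc] PC[OF ac] QC by blast
    ultimately show ?thesis using \<open>?Q = C\<close> \<open>?R = {}\<close> by (simp only: Un_empty_left)
  qed
  ultimately show False using prod_C by simp
qed

lemma component_card_attach: "card (attach F) = 2"
proof (rule ccontr)
  assume "card (attach F) \<noteq> 2"
  then have "3 \<le> card (attach F)" using component_two_attachments by simp
  then obtain T where "T \<subseteq> attach F" "card T = 3"
    using obtain_subset_with_card_n by metis
  then show False using component_no_third_attachment by (auto simp: card_3_iff)
qed

lemma component_bridge_edges: "bridge_edges F"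
  unfolding bridge_edges_def
proof (intro conjI ballI impI)
  show "F \<subseteq> E" by (auto simp: F_def)
  show "F \<inter> C = {}" using component_disjoint_C by (auto simp: F_def verts_def)
  show "card (attach F) = 2" by (rule component_card_attach)
  fix f v g assume "f \<in> F" "v \<in> ends f - verts ends C" "g \<in> E" "v \<in> ends g"
  then show "g \<in> F" using component_end[of f v] by (auto simp: F_def)
qed

end

section \<open>Chords and components together: the bridges partition the edges off
  \<open>C\<close>\<close>

lemma chord_bridge_edges:
  assumes "f \<in> E" "f \<notin> C" "ends f \<subseteq> verts ends C"
  shows "bridge_edges {f}"
proof -
  have "attach {f} = ends f" using assms by (auto simp: attach_def verts_def)
  then show ?thesis using assms card_ends by (auto simp: bridge_edges_def)
qed

lemma bridges_cases:
  assumes "D \<in> bridges V E ends C"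
  obtains (chord) f where "D = (ends f, {f})" "f \<in> E" "f \<notin> C" "ends f \<subseteq> verts ends C"
  | (component) K where "K \<in> components_off V E ends (verts ends C)"
      "D = (K \<union> verts ends {f\<in>E. ends f \<inter> K \<noteq> {}}, {f\<in>E. ends f \<inter> K \<noteq> {}})"
  using assms unfolding bridges_def by blast

lemma bridges_bridge_edges:
  assumes "D \<in> bridges V E ends C"
  shows "bridge_edges (snd D)" "fst D = verts ends (snd D)"
  using assms
proof (atomize(full), cases rule: bridges_cases)
  case (chord f)
  then show "bridge_edges (snd D) \<and> fst D = verts ends (snd D)"
    using chord_bridge_edges by (simp add: verts_def)
next
  case (component K)
  then show "bridge_edges (snd D) \<and> fst D = verts ends (snd D)"
    using component_bridge_edges[of K] component_sub_verts[of K] by auto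
qed

text \<open>A walk inside \<open>K\<close> that starts in \<open>L\<close> stays in
  \<open>L\<close>, as \<open>L\<close> is closed under edges off \<open>X\<close>.\<close>

lemma component_subset:
  assumes K: "K \<in> components_off V E ends X" and L: "L \<in> components_off V E ends X" and "K \<inter> L \<noteq> {}"
  shows "K \<subseteq> L"
proof
  fix v assume v: "v \<in> K"
  obtain u where u: "u \<in> K" "u \<in> L" using assms by blast
  have "(\<lambda>x y. \<exists>f\<in>{f\<in>E. ends f \<subseteq> K}. ends f = {x, y})\<^sup>*\<^sup>* u v"
    using K u v by (auto simp: components_off_def connected_sub_def)
  then show "v \<in> L"
  proof (rule reach_closed)
    fix f assume f: "f \<in> {f\<in>E. ends f \<subseteq> K}" "ends f \<inter> L \<noteq> {}"
    then have "ends f \<subseteq> V - X" using K by (auto simp: components_off_def)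
    then show "ends f \<subseteq> L" using L f unfolding components_off_def by blast
  qed (fact u(2))
qed

lemma bridges_disjoint:
  assumes D: "D \<in> bridges V E ends C" "D' \<in> bridges V E ends C" "D \<noteq> D'"
  shows "snd D \<inter> snd D' = {}"
  using D(1)
proof (cases rule: bridges_cases)
  case (chord f)
  show ?thesis using D(2)
  proof (cases rule: bridges_cases)
    case (chord g)
    then show ?thesis using \<open>D = (ends f, {f})\<close> D(3) by auto
  next
    case (component K)
    then show ?thesis using chord component_disjoint_C[of K] by auto
  qed
next
  case (component K)
  note DK = component
  show ?thesis using D(2)
  proof (cases rule: bridges_cases)
    case (chord g)
    then show ?thesis using DK component_disjoint_C[of K] by auto
  next
    case (component L)
    then have "K \<noteq> L" using DK D(3) by auto
    then have KL: "K \<inter> L = {}" using component_subset[OF DK(1) component(1)] component_subset[OF component(1) DK(1)] by blast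
    show ?thesis
    proof (rule ccontr)
      assume "snd D \<inter> snd D' \<noteq> {}"
      then obtain f where f: "f \<in> E" "ends f \<inter> K \<noteq> {}" "ends f \<inter> L \<noteq> {}" using DK component by auto
      then obtain v where v: "v \<in> ends f" "v \<in> L" by blast
      then have "v \<in> K"
        using component_end[OF DK(1), of f v] component_disjoint_C[OF component(1)] f by auto
      then show False using KL v by blast
    qed
  qed
qed

text \<open>If \<open>f\<close> is not a chord, it has an end \<open>v\<close> off \<open>C\<close>;
  the component is what \<open>v\<close> reaches by edges avoiding the vertices of
  \<open>C\<close>.\<close>

lemma bridges_cover:
  assumes f: "f \<in> E" "f \<notin> C"
  shows "\<exists>D\<in>bridges V E ends C. f \<in> snd D"
proof (cases "ends f \<subseteq> verts ends C")
  case True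
  then have "(ends f, {f}) \<in> bridges V E ends C" using f by (auto simp: bridges_def)
  then show ?thesis by force
next
  case False
  then obtain v where v: "v \<in> ends f" "v \<notin> verts ends C" by blast
  let ?H = "{g\<in>E. ends g \<inter> verts ends C = {}}"
  let ?K = "reachable ?H v"
  have HE: "?H \<subseteq> E" by blast
  have vV: "v \<in> V" using ends_subset f v by blast
  have KV: "?K \<subseteq> V - verts ends C"
  proof
    fix u assume "u \<in> ?K"
    then have "(\<lambda>x y. \<exists>f\<in>?H. ends f = {x, y})\<^sup>*\<^sup>* v u" by (simp add: reachable_def)
    then show "u \<in> V - verts ends C"
      by (rule reach_closed) (use v vV ends_subset in auto)
  qed
  \<comment> \<open>Connectedness of a component is demanded by edges inside it, so walks in
    \<open>?H\<close> are shown to use only edges with both ends in \<open>?K\<close>.\<close>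
  have reach: "(\<lambda>x y. \<exists>f\<in>{f\<in>E. ends f \<subseteq> ?K}. ends f = {x, y})\<^sup>*\<^sup>* v u" if "u \<in> ?K" for u
  proof -
    have "(\<lambda>x y. \<exists>f\<in>?H. ends f = {x, y})\<^sup>*\<^sup>* v u" using that by (simp add: reachable_def)
    then show ?thesis
    proof (induction rule: rtranclp_induct)
      case (step y z)
      then obtain g where g: "g \<in> ?H" "ends g = {y, z}" by blast
      have "y \<in> ?K" using step.hyps(1) by (simp add: reachable_def)
      then have "ends g \<subseteq> ?K" using reachable_ends[OF HE g(1)] g(2) by auto
      then show ?case using step.IH g by (intro rtranclp.rtrancl_into_rtrancl[OF step.IH]) auto
    qed simp
  qed
  have "connected_sub ends ?K {f\<in>E. ends f \<subseteq> ?K}"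
    unfolding connected_sub_def using reach reach_sym[OF reach] by (meson rtranclp_trans)
  moreover have "ends g \<subseteq> ?K" if "g \<in> E" "ends g \<subseteq> V - verts ends C" "ends g \<inter> ?K \<noteq> {}" for g
    using reachable_ends[OF HE _ that(3)] that by blast
  ultimately have "?K \<in> components_off V E ends (verts ends C)"
    using KV reachable_refl[of v ?H] unfolding components_off_def by blast
  then have "(?K \<union> verts ends {g\<in>E. ends g \<inter> ?K \<noteq> {}}, {g\<in>E. ends g \<inter> ?K \<noteq> {}}) \<in> bridges V E ends C"
    unfolding bridges_def by blast
  moreover have "f \<in> {g\<in>E. ends g \<inter> ?K \<noteq> {}}" using f v reachable_refl[of v ?H] by blast
  ultimately show ?thesis by force
qed

text \<open>A forest bridge is its own ear, so its boundary consists of two vertices and it can be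
  listed as a path.\<close>

lemma bridge_is_path_iff_forest:
  assumes "D \<in> bridges V E ends C"
  shows "is_path ends D \<longleftrightarrow> forest ends (snd D)"
proof -
  note B = bridges_bridge_edges[OF assms]
  have D: "D = (verts ends (snd D), snd D)" using B(2) by (metis prod.collapse)
  show ?thesis
  proof
    assume "is_path ends D"
    then show "forest ends (snd D)"
      using is_path_forest[of "fst D" "snd D"] bridge_edgesD(1)[OF B(1)] by simp
  next
    assume f: "forest ends (snd D)"
    have "bnd (snd D) = attach (snd D)" using forest_bridge_ear[OF B(1) f] by (simp add: ear_def)
    then show "is_path ends D"
      using forest_is_path[OF f bridge_edgesD(1)[OF B(1)]] bridge_edgesD(3)[OF B(1)] D by simp
  qed
qed

end

theorem mainTheorem7:
  fixes V :: "'v set" and E :: "'e set" and ends :: "'e \<Rightarrow> 'v set"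
    and sigma :: "'e \<Rightarrow> int" and e :: 'e and C :: "'e set"
    and D1 D2 :: "'v set \<times> 'e set"
  assumes "graph V E ends" and "signature E sigma"
    and "is_block V E ends"
    and "card E \<noteq> 1"
    and "\<not> is_circle E ends E"
    and "battery_circle E ends sigma e C"
    and "bridges V E ends C = {D1, D2}" and "D1 \<noteq> D2"
  shows "(is_path ends D1 \<and> is_path ends D2 \<longrightarrow>
            (\<forall>f\<in>snd D1 \<union> snd D2. pos_battery E ends sigma f))
       \<and> (\<not> (is_path ends D1 \<and> is_path ends D2) \<longrightarrow>
            (\<forall>f\<in>snd D1 \<union> snd D2. \<not> pos_battery E ends sigma f))"
proof -
  interpret battery V E ends sigma e C
    using assms(1-3,6) by unfold_locales
  have D: "D1 \<in> bridges V E ends C" "D2 \<in> bridges V E ends C" using assms(7) by auto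
  note B1 = bridges_bridge_edges(1)[OF D(1)] and B2 = bridges_bridge_edges(1)[OF D(2)]
  have disj: "snd D1 \<inter> snd D2 = {}" "snd D2 \<inter> snd D1 = {}"
    using bridges_disjoint[OF D assms(8)] by auto
  have cover: "E \<subseteq> C \<union> snd D1 \<union> snd D2" "E \<subseteq> C \<union> snd D2 \<union> snd D1"
    using bridges_cover assms(7) by auto
  note paths = bridge_is_path_iff_forest[OF D(1)] bridge_is_path_iff_forest[OF D(2)]
  \<comment> \<open>Both cases were proved for an edge of the first bridge; exchanging the bridges
    covers the second.\<close>
  have "pos_battery E ends sigma f"
    if "forest ends (snd D1)" "forest ends (snd D2)" "f \<in> snd D1 \<union> snd D2" for f
    using forest_bridges_pos_battery[OF B1 B2 disj(1) that(1,2) cover(1), of f]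
      forest_bridges_pos_battery[OF B2 B1 disj(2) that(2,1) cover(2), of f] that(3) by blast
  moreover have "\<not> pos_battery E ends sigma f"
    if "\<not> (forest ends (snd D1) \<and> forest ends (snd D2))" "f \<in> snd D1 \<union> snd D2" for f
    using non_forest_bridges_not_pos_battery[OF B1 B2 disj(1), of f]
      non_forest_bridges_not_pos_battery[OF B2 B1 disj(2), of f] that by blast
  ultimately show ?thesis unfolding paths by blast
qed

end
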